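(* Let $K\ge1$, $N_r\ge K$, $\tau_p\ge1$, $\sigma_p^2,\sigma_d^2>0$, and for $k=1,\dots,K$ let $\alpha_k,P_k,P_{p,k},c_k>0$ and $a_k\in\mathbb{C}$ with $|a_k|<1$. Define $s_k=\frac{\sigma_p^2}{\alpha_k^2P_{p,k}\tau_p}$, $$\hat e_k=\frac{c_k(c_k+s_k-|a_k|^2c_k)}{(c_k+s_k)^2-|a_k|^2c_k^2},\quad \check e_k=\frac{a_kc_ks_k}{(c_k+s_k)^2-|a_k|^2c_k^2},\quad z_k=\frac{c_ks_k(c_k+s_k-|a_k|^2c_k)}{(c_k+s_k)^2-|a_k|^2c_k^2},$$ $\phi_k=\alpha_k^2P_k(\hat e_kc_k+\check e_kc_ka_k^* )$, $\phi=\phi_1$, and $\beta=\sum_{k=1}^K\alpha_k^2P_kz_k+\sigma_d^2$. Then (i) the equation $$\beta=\frac{N_r\phi}{\bar\gamma}-\sum_{k=2}^K\frac{\phi_k}{1+\bar\gamma\phi_k/\phi}$$ has a unique positive solution $\bar\gamma$; and (ii) if $\mathbf{b}\sim\mathcal{CN}(\mathbf{0},\phi\mathbf{I}_{N_r})$ and $\mathbf{b}_k\sim\mathcal{CN}(\mathbf{0},\phi_k\mathbf{I}_{N_r})$, $k=2,\dots,K$, are independent and $\gamma=\mathbf{b}^H\big(\sum_{k=2}^K\mathbf{b}_k\mathbf{b}_k^H+\beta\mathbf{I}_{N_r}\big)^{-1}\mathbf{b}$, then as $N_r\to\infty$ with $\limsup K/N_r<1$ and with all $\phi,\phi_k,\beta$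 confined to a fixed compact subset of $(0,\infty)$, $\frac1{N_r}(\gamma-\bar\gamma)\to0$ almost surely and $\frac1{N_r}(\mathbb{E}[\gamma]-\bar\gamma)\to0$; that is, $\bar\gamma$ is the asymptotic average SINR of the tagged user (user 1).
   Context: Setting: uplink MU-MIMO with $N_r$ BS antennas and $K$ single-antenna users, i.i.d. channel coefficients: for user $k$ the channel covariance is $c_k\mathbf{I}_{N_r}$, the AR(1) transition matrix is $a_k\mathbf{I}_{N_r}$, and the pilot estimation noise covariance is $s_k\mathbf{I}_{N_r}$. Then $\phi_k\mathbf{I}$ is the covariance of $\mathbf{b}_k=\alpha_k\sqrt{P_k}(\hat e_k\hat{\mathbf{h}}_k(t)+\check e_k\hat{\mathbf{h}}_k(t-1))$, $z_k\mathbf{I}$ is the channel estimation error covariance, and $\gamma$ is the instantaneous SINR under the MMSE receiver. $a^*$ denotes complex conjugate. *)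

theory Defs
  imports "HOL-Probability.Probability" "Jordan_Normal_Form.Gauss_Jordan_Elimination"
begin

definition s_noise :: "real \<Rightarrow> nat \<Rightarrow> real \<Rightarrow> real \<Rightarrow> real" where
  "s_noise sp2 taup alpha Pp = sp2 / (alpha\<^sup>2 * Pp * real taup)"

definition den_k :: "real \<Rightarrow> real \<Rightarrow> complex \<Rightarrow> real" where
  "den_k c s a = (c + s)\<^sup>2 - (cmod a)\<^sup>2 * c\<^sup>2"

definition ehat :: "real \<Rightarrow> real \<Rightarrow> complex \<Rightarrow> real" where
  "ehat c s a = c * (c + s - (cmod a)\<^sup>2 * c) / den_k c s a"

definition echeck :: "real \<Rightarrow> real \<Rightarrow> complex \<Rightarrow> complex" where
  "echeck c s a = a * complex_of_real (c * s / den_k c s a)"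

definition zerr :: "real \<Rightarrow> real \<Rightarrow> complex \<Rightarrow> real" where
  "zerr c s a = c * s * (c + s - (cmod a)\<^sup>2 * c) / den_k c s a"

definition phi_k :: "real \<Rightarrow> real \<Rightarrow> real \<Rightarrow> real \<Rightarrow> complex \<Rightarrow> complex" where
  "phi_k alpha P c s a =
     complex_of_real (alpha\<^sup>2 * P) *
       (complex_of_real (ehat c s a * c) + echeck c s a * complex_of_real c * cnj a)"

definition phis :: "real \<Rightarrow> nat \<Rightarrow> (nat \<Rightarrow> real) \<Rightarrow> (nat \<Rightarrow> real) \<Rightarrow> (nat \<Rightarrow> real)
                    \<Rightarrow> (nat \<Rightarrow> real) \<Rightarrow> (nat \<Rightarrow> complex) \<Rightarrow> nat \<Rightarrow> complex" where
  "phis sp2 taup alpha P Pp c a k =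
     phi_k (alpha k) (P k) (c k) (s_noise sp2 taup (alpha k) (Pp k)) (a k)"

definition beta_tot :: "nat \<Rightarrow> real \<Rightarrow> real \<Rightarrow> nat \<Rightarrow> (nat \<Rightarrow> real) \<Rightarrow> (nat \<Rightarrow> real)
                        \<Rightarrow> (nat \<Rightarrow> real) \<Rightarrow> (nat \<Rightarrow> real) \<Rightarrow> (nat \<Rightarrow> complex) \<Rightarrow> real" where
  "beta_tot K sp2 sd2 taup alpha P Pp c a =
     (\<Sum>k\<in>{1..K}. (alpha k)\<^sup>2 * P k * zerr (c k) (s_noise sp2 taup (alpha k) (Pp k)) (a k)) + sd2"

definition valid_params :: "nat \<Rightarrow> nat \<Rightarrow> nat \<Rightarrow> real \<Rightarrow> real \<Rightarrow> (nat \<Rightarrow> real) \<Rightarrow> (nat \<Rightarrow> real)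
                        \<Rightarrow> (nat \<Rightarrow> real) \<Rightarrow> (nat \<Rightarrow> real) \<Rightarrow> (nat \<Rightarrow> complex) \<Rightarrow> bool" where
  "valid_params K Nr taup sp2 sd2 alpha P Pp c a \<longleftrightarrow>
     1 \<le> K \<and> K \<le> Nr \<and> 1 \<le> taup \<and> sp2 > 0 \<and> sd2 > 0 \<and>
     (\<forall>k\<in>{1..K}. alpha k > 0 \<and> P k > 0 \<and> Pp k > 0 \<and> c k > 0 \<and> cmod (a k) < 1)"

definition gbar_eq :: "nat \<Rightarrow> nat \<Rightarrow> (nat \<Rightarrow> complex) \<Rightarrow> real \<Rightarrow> real \<Rightarrow> bool" where
  "gbar_eq Nr K ph beta g \<longleftrightarrow>
     complex_of_real beta =
       of_nat Nr * ph 1 / complex_of_real g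
       - (\<Sum>k\<in>{2..K}. ph k / (1 + complex_of_real g * ph k / ph 1))"

definition gbar :: "nat \<Rightarrow> nat \<Rightarrow> (nat \<Rightarrow> complex) \<Rightarrow> real \<Rightarrow> real" where
  "gbar Nr K ph beta = (THE g. g > 0 \<and> gbar_eq Nr K ph beta g)"

definition sinr :: "nat \<Rightarrow> nat \<Rightarrow> real \<Rightarrow> (nat \<Rightarrow> complex) \<Rightarrow> (nat \<Rightarrow> nat \<Rightarrow> complex) \<Rightarrow> complex" where
  "sinr n K beta b bk =
     (let A = mat n n (\<lambda>(i, j). (\<Sum>k\<in>{2..K}. bk k i * cnj (bk k j))
                                 + (if i = j then complex_of_real beta else 0));
          Ai = the (mat_inverse A)
      in (\<Sum>i<n. \<Sum>j<n. cnj (b i) * (Ai $$ (i, j)) * b j))"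

text \<open>X k (k = 1..K) are independent random vectors in C^n with X k ~ CN(0, v k I_n):
  all real and imaginary parts of all entries are mutually independent, each N(0, v k / 2).\<close>
definition indep_CN_vectors :: "'a measure \<Rightarrow> nat \<Rightarrow> nat \<Rightarrow> (nat \<Rightarrow> real)
                                \<Rightarrow> (nat \<Rightarrow> 'a \<Rightarrow> nat \<Rightarrow> complex) \<Rightarrow> bool" where
  "indep_CN_vectors M n K v X \<longleftrightarrow>
     prob_space.indep_vars M (\<lambda>_. borel)
        (\<lambda>(k, i, re). \<lambda>\<omega>. if re then Re (X k \<omega> i) else Im (X k \<omega> i))
        ({1..K} \<times> {..<n} \<times> UNIV) \<and>
     (\<forall>k\<in>{1..K}. \<forall>i<n.
        distributed M lborel (\<lambda>\<omega>. Re (X k \<omega> i)) (\<lambda>x. ennreal (normal_density 0 (sqrt (v k / 2)) x)) \<and>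
        distributed M lborel (\<lambda>\<omega>. Im (X k \<omega> i)) (\<lambda>x. ennreal (normal_density 0 (sqrt (v k / 2)) x)))"

end

theory Submission
  imports Defs
begin

text \<open>Let \<open>A\<^sub>S = (\<Sum>k\<in>S. b\<^sub>k b\<^sub>k\<^sup>H) + \<beta> I\<close> and \<open>q\<^sub>k = b\<^sub>k\<^sup>H A\<^sub>S\<^sub>-\<^sub>k\<^sup>-\<^sup>1 b\<^sub>k\<close>.
  Taking the trace of \<open>A\<^sub>S A\<^sub>S\<^sup>-\<^sup>1 = I\<close> and using the Sherman-Morrison formula gives
  \<open>\<beta> tr A\<^sub>S\<^sup>-\<^sup>1 = n - |S| + (\<Sum>k\<in>S. 1 / (1 + q\<^sub>k))\<close>. Since \<open>b\<^sub>k\<close> is independent of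
  \<open>A\<^sub>S\<^sub>-\<^sub>k\<close>, the form \<open>q\<^sub>k\<close> concentrates around \<open>\<phi>\<^sub>k tr A\<^sub>S\<^sub>-\<^sub>k\<^sup>-\<^sup>1\<close>, which by the same identity is at
  least of order \<open>n\<close>; so the last sum is negligible and \<open>\<gamma> / n\<close> behaves like
  \<open>\<phi> (n - K + 1) / (n \<beta>)\<close>. The equation defining the deterministic equivalent has the same leading
  term. Concentration is measured by fourth moments, which are of order \<open>n\<^sup>2\<close> for a quadratic form
  whose matrix has bounded rows; the resulting bound \<open>O(1 / n\<^sup>2)\<close> is summable, and yields both almost
  sure convergence and convergence of the mean.\<close>

section \<open>Resolvents of regularized Gram matrices\<close>

text \<open>The hypotheses do not relate the vectors belonging to different n, and K and all
  parameters may change with n, so almost sure convergence has to come from a bound for each n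
  separately that is summable over n. The second moment of a normalized centered quadratic form
  decays only like 1/n; this is what forces fourth moments, and with them eighth moments of the
  Gaussian coordinates. Spectral theory is avoided. For an inverse G of A = sum of b_k b_k^H + beta
  I, the value x^H G x is an explicit sum of squares. This yields positivity and, at unit vectors,
  the bound 1/beta^2 on the squared norm of each row, which together with Hermitian symmetry is all
  that the moment estimate asks of G. The gap between K/n and 1 keeps every trace of order n. Hence
  each q_k is typically of order n and a sum of at most n terms 1 / (1 + q_k) typically stays
  bounded; the corresponding sum in the equation for the deterministic equivalent is bounded for the
  same reason.\<close>

definition qform :: "nat \<Rightarrow> (nat \<Rightarrow> nat \<Rightarrow> complex) \<Rightarrow> (nat \<Rightarrow> complex) \<Rightarrow> complex" where
  "qform n G x = (\<Sum>i<n. \<Sum>j<n. cnj (x i) * G i j * x j)"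

definition tr :: "nat \<Rightarrow> (nat \<Rightarrow> nat \<Rightarrow> complex) \<Rightarrow> complex" where
  "tr n G = (\<Sum>i<n. G i i)"

text \<open>Matrices are plain functions of which only the entries below \<open>n\<close> count. A
  one-sided notion suffices, since for Hermitian \<open>A\<close> it is two-sided by
  \<open>right_inv_left_inv\<close>.\<close>

definition right_inv :: "nat \<Rightarrow> (nat \<Rightarrow> nat \<Rightarrow> complex) \<Rightarrow> (nat \<Rightarrow> nat \<Rightarrow> complex) \<Rightarrow> bool" where
  "right_inv n A G \<longleftrightarrow> (\<forall>i<n. \<forall>j<n. (\<Sum>l<n. A i l * G l j) = (if i = j then 1 else 0))"

text \<open>The index set is arbitrary because the argument removes single vectors from
  \<open>{2..K}\<close>.\<close>

definition gram :: "real \<Rightarrow> nat set \<Rightarrow> (nat \<Rightarrow> nat \<Rightarrow> complex) \<Rightarrow> nat \<Rightarrow> nat \<Rightarrow> complex" where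
  "gram beta S b i j = (\<Sum>k\<in>S. b k i * cnj (b k j)) + (if i = j then complex_of_real beta else 0)"

text \<open>This copies the expression inside \<open>sinr\<close>, so that
  \<open>sinr_eq_qform\<close> holds by unfolding; that \<open>mat_inverse\<close> succeeds is
  settled later, in \<open>resolvent_right_inv\<close>.\<close>

definition resolvent :: "nat \<Rightarrow> real \<Rightarrow> nat set \<Rightarrow> (nat \<Rightarrow> nat \<Rightarrow> complex) \<Rightarrow> nat \<Rightarrow> nat \<Rightarrow> complex" where
  "resolvent n beta S b i j = the (mat_inverse (mat n n (\<lambda>(i, j). gram beta S b i j))) $$ (i, j)"

lemma sinr_eq_qform: "sinr n K beta b bk = qform n (resolvent n beta {2..K} bk) b"
  by (simp add: sinr_def qform_def resolvent_def gram_def Let_def)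

lemma cnj_gram: "cnj (gram beta S b i j) = gram beta S b j i"
  by (simp add: gram_def mult.commute)

text \<open>Evaluate G^H A G in two ways: A G = I makes it G^H, while A^H = A makes it (A G)^H G =
  G.\<close>

lemma right_inv_hermitian:
  assumes herm: "\<And>i j. cnj (A i j) = A j i" and inv: "right_inv n A G" and "i < n" "j < n"
  shows "cnj (G j i) = G i j"
proof -
  have "cnj (G j i) = (\<Sum>l<n. cnj (G l i) * (if l = j then 1 else 0))"
    using \<open>j < n\<close> by (simp add: if_distrib cong: if_cong)
  also have "\<dots> = (\<Sum>l<n. cnj (G l i) * (\<Sum>m<n. A l m * G m j))"
    using inv \<open>j < n\<close> by (intro sum.cong) (auto simp: right_inv_def)
  also have "\<dots> = (\<Sum>l<n. \<Sum>m<n. cnj (G l i) * A l m * G m j)"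
    by (simp add: sum_distrib_left mult.assoc)
  also have "\<dots> = (\<Sum>m<n. \<Sum>l<n. cnj (G l i) * A l m * G m j)"
    by (rule sum.swap)
  also have "\<dots> = (\<Sum>m<n. G m j * cnj (\<Sum>l<n. A m l * G l i))"
    by (simp add: sum_distrib_left herm mult.assoc mult.commute mult.left_commute)
  also have "\<dots> = (\<Sum>m<n. G m j * (if m = i then 1 else 0))"
    using inv \<open>i < n\<close> by (intro sum.cong) (auto simp: right_inv_def)
  also have "\<dots> = G i j"
    using \<open>i < n\<close> by (simp add: if_distrib cong: if_cong)
  finally show ?thesis .
qed

lemma right_inv_left_inv:
  assumes herm: "\<And>i j. cnj (A i j) = A j i" and inv: "right_inv n A G"
  shows "right_inv n G A"
  unfolding right_inv_def
proof (intro allI impI)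
  fix i j assume ij: "i < n" "j < n"
  have "(\<Sum>l<n. G i l * A l j) = cnj (\<Sum>l<n. A j l * G l i)"
    using right_inv_hermitian[OF assms] ij by (auto simp: herm mult.commute intro!: sum.cong)
  then show "(\<Sum>l<n. G i l * A l j) = (if i = j then 1 else 0)"
    using inv ij by (simp add: right_inv_def del: cnj_sum)
qed

section \<open>Positivity and row bounds for inverses of regularized Gram matrices\<close>

lemma gram_apply:
  assumes "i < n"
  shows "(\<Sum>l<n. gram beta S b i l * y l) =
    (\<Sum>k\<in>S. b k i * (\<Sum>l<n. cnj (b k l) * y l)) + of_real beta * y i"
proof -
  have "(\<Sum>l<n. gram beta S b i l * y l) =
     (\<Sum>l<n. (\<Sum>k\<in>S. b k i * cnj (b k l)) * y l) + (\<Sum>l<n. (if i = l then of_real beta else 0) * y l)"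
    by (simp add: gram_def ring_distribs sum.distrib)
  also have "(\<Sum>l<n. (\<Sum>k\<in>S. b k i * cnj (b k l)) * y l) = (\<Sum>k\<in>S. b k i * (\<Sum>l<n. cnj (b k l) * y l))"
    by (simp add: sum_distrib_right sum_distrib_left mult.assoc) (rule sum.swap)
  also have "(\<Sum>l<n. (if i = l then of_real beta else 0) * y l) = of_real beta * y i"
    using assms by (simp add: if_distrib[of "\<lambda>x. x * _"] cong: if_cong)
  finally show ?thesis .
qed

text \<open>With y = G x, and hence A y = x, the form x^H G x equals y^H A y, and A is a sum of
  rank-one squares plus beta I.\<close>

lemma qform_gram_inv:
  assumes inv: "right_inv n (gram beta S b) G"
  defines "y \<equiv> \<lambda>x i. \<Sum>j<n. G i j * x j"
  shows "qform n G x = of_real ((\<Sum>k\<in>S. (cmod (\<Sum>l<n. cnj (b k l) * y x l))\<^sup>2) + beta * (\<Sum>i<n. (cmod (y x i))\<^sup>2))"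
proof -
  have x: "(\<Sum>l<n. gram beta S b i l * y x l) = x i" if "i < n" for i
  proof -
    have "(\<Sum>l<n. gram beta S b i l * y x l) = (\<Sum>j<n. (\<Sum>l<n. gram beta S b i l * G l j) * x j)"
      by (simp add: y_def sum_distrib_left sum_distrib_right mult.assoc) (rule sum.swap)
    also have "\<dots> = (\<Sum>j<n. (if i = j then 1 else 0) * x j)"
      using inv that by (intro sum.cong) (auto simp: right_inv_def)
    also have "\<dots> = x i"
      using that by (simp add: if_distrib[of "\<lambda>x. x * _"] cong: if_cong)
    finally show ?thesis .
  qed
  have "qform n G x = (\<Sum>i<n. cnj (x i) * y x i)"
    by (simp add: qform_def y_def sum_distrib_left mult.assoc)
  also have "\<dots> = (\<Sum>i<n. cnj ((\<Sum>k\<in>S. b k i * (\<Sum>l<n. cnj (b k l) * y x l)) + of_real beta * y x i) * y x i)"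
    using x gram_apply[of _ n beta S b "y x"] by (intro sum.cong) auto
  also have "\<dots> = (\<Sum>i<n. \<Sum>k\<in>S. cnj (b k i) * y x i * cnj (\<Sum>l<n. cnj (b k l) * y x l))
      + (\<Sum>i<n. of_real beta * (y x i * cnj (y x i)))"
    by (simp add: ring_distribs sum.distrib sum_distrib_right mult.assoc mult.commute mult.left_commute del: cnj_sum)
      (simp add: sum_distrib_right sum_distrib_left mult.assoc mult.commute mult.left_commute)
  also have "(\<Sum>i<n. \<Sum>k\<in>S. cnj (b k i) * y x i * cnj (\<Sum>l<n. cnj (b k l) * y x l))
     = (\<Sum>k\<in>S. (\<Sum>i<n. cnj (b k i) * y x i) * cnj (\<Sum>l<n. cnj (b k l) * y x l))"
    by (subst sum.swap) (simp add: sum_distrib_right)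
  moreover have "(complex_of_real (cmod z))\<^sup>2 = z * cnj z" for z
    by (metis complex_norm_square of_real_power)
  ultimately show ?thesis
    by (simp add: sum_distrib_left del: cnj_sum)
qed

lemma qform_gram_inv_nonneg:
  assumes "right_inv n (gram beta S b) G" "beta > 0"
  shows "qform n G x = of_real (Re (qform n G x))" "Re (qform n G x) \<ge> 0"
  using assms(2) by (auto simp: qform_gram_inv[OF assms(1)] intro!: add_nonneg_nonneg sum_nonneg mult_nonneg_nonneg)

text \<open>Evaluate the form at the j-th unit vector: y is then the j-th column of
  \<open>G\<close>, and dropping the squares that come from the vectors leaves the beta
  term.\<close>

lemma gram_inv_diag:
  assumes inv: "right_inv n (gram beta S b) G" and "beta > 0" "j < n"
  shows "G j j = of_real (Re (G j j))" "beta * (\<Sum>i<n. (cmod (G i j))\<^sup>2) \<le> Re (G j j)"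
proof -
  define e :: "nat \<Rightarrow> complex" where "e = (\<lambda>i. if i = j then 1 else 0)"
  have y: "(\<Sum>l<n. G i l * e l) = G i j" for i
    using \<open>j < n\<close> by (simp add: e_def if_distrib cong: if_cong)
  have "qform n G e = (\<Sum>i<n. cnj (e i) * (\<Sum>l<n. G i l * e l))"
    by (simp add: qform_def sum_distrib_left mult.assoc)
  also have "\<dots> = G j j"
    unfolding y using \<open>j < n\<close> by (simp add: e_def if_distrib[of "\<lambda>x. x * _"] if_distrib[of cnj] cong: if_cong)
  finally have q: "qform n G e = G j j" .
  show "G j j = of_real (Re (G j j))"
    using qform_gram_inv_nonneg(1)[OF inv \<open>beta > 0\<close>, of e] by (simp add: q)
  show "beta * (\<Sum>i<n. (cmod (G i j))\<^sup>2) \<le> Re (G j j)"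
    using qform_gram_inv[OF inv, of e] by (simp add: q y sum_nonneg)
qed

text \<open>This stands in for the operator norm bound 1/beta. A diagonal entry r is part of its own
  column, so beta r^2 <= r and r <= 1/beta; then the column has squared norm at most r/beta.
  Hermitian symmetry turns the column into a row.\<close>

lemma gram_inv_row_bound:
  assumes inv: "right_inv n (gram beta S b) G" and "beta > 0" "i < n"
  shows "(\<Sum>j<n. (cmod (G i j))\<^sup>2) \<le> 1 / beta\<^sup>2"
proof -
  define r where "r = Re (G i i)"
  note d = gram_inv_diag[OF assms]
  have "(cmod (G i i))\<^sup>2 \<le> (\<Sum>j<n. (cmod (G j i))\<^sup>2)"
    using \<open>i < n\<close> by (intro member_le_sum) auto
  moreover have "(cmod (G i i))\<^sup>2 = r\<^sup>2"
    by (subst d(1)) (simp add: r_def)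
  ultimately have rr: "beta * r\<^sup>2 \<le> r"
    using d(2) \<open>beta > 0\<close> by (smt (verit) mult_left_mono r_def)
  have r0: "r \<ge> 0"
    using rr \<open>beta > 0\<close> by (smt (verit) mult_nonneg_nonneg zero_le_power2)
  then have r1: "r \<le> 1 / beta"
    using rr \<open>beta > 0\<close> by (cases "r = 0") (auto simp: field_simps power2_eq_square)
  have "(\<Sum>j<n. (cmod (G i j))\<^sup>2) = (\<Sum>j<n. (cmod (G j i))\<^sup>2)"
  proof (intro sum.cong refl)
    fix j assume "j \<in> {..<n}"
    then have "G i j = cnj (G j i)"
      using right_inv_hermitian[OF cnj_gram inv] \<open>i < n\<close> by simp
    then show "(cmod (G i j))\<^sup>2 = (cmod (G j i))\<^sup>2" by simp
  qed
  also have "\<dots> \<le> r / beta"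
    using d(2) \<open>beta > 0\<close> by (simp add: r_def field_simps)
  also have "\<dots> \<le> 1 / beta\<^sup>2"
    using r1 \<open>beta > 0\<close> by (simp add: field_simps power2_eq_square)
  finally show "(\<Sum>j<n. (cmod (G i j))\<^sup>2) \<le> 1 / beta\<^sup>2" .
qed

text \<open>The Sherman-Morrison inverse of A + u u^H when \<open>G\<close> inverts A. It depends on
  \<open>G\<close> and \<open>u\<close> only through field operations, which later makes resolvents
  visibly measurable.\<close>

definition rank_one_update ::
    "nat \<Rightarrow> (nat \<Rightarrow> nat \<Rightarrow> complex) \<Rightarrow> (nat \<Rightarrow> complex) \<Rightarrow> nat \<Rightarrow> nat \<Rightarrow> complex" where
  "rank_one_update n G u i j =
     G i j - (\<Sum>l<n. G i l * u l) * (\<Sum>l<n. cnj (u l) * G l j) / (1 + qform n G u)"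

lemma sherman_morrison:
  assumes inv: "right_inv n (gram beta S b) G" and "beta > 0" "k \<notin> S" "finite S"
  shows "right_inv n (gram beta (insert k S) b) (rank_one_update n G (b k))"
  unfolding right_inv_def
proof (intro allI impI)
  fix i j assume ij: "i < n" "j < n"
  define v where "v i = (\<Sum>l<n. G i l * b k l)" for i
  define w where "w j = (\<Sum>l<n. cnj (b k l) * G l j)" for j
  define q where "q = qform n G (b k)"
  \<comment> \<open>The denominator cannot vanish because q is real and nonnegative.\<close>
  have q0: "1 + q \<noteq> 0"
    using qform_gram_inv_nonneg[OF inv \<open>beta > 0\<close>, of "b k"]
    by (simp add: q_def complex_eq_iff add_nonneg_eq_0_iff)
  have qv: "(\<Sum>l<n. cnj (b k l) * v l) = q"
    by (simp add: q_def qform_def v_def sum_distrib_left mult.assoc)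
  have Av: "(\<Sum>l<n. gram beta S b i l * v l) = b k i"
  proof -
    have "(\<Sum>l<n. gram beta S b i l * v l) = (\<Sum>m<n. (\<Sum>l<n. gram beta S b i l * G l m) * b k m)"
      by (simp add: v_def sum_distrib_left sum_distrib_right mult.assoc) (rule sum.swap)
    also have "\<dots> = (\<Sum>m<n. (if i = m then 1 else 0) * b k m)"
      using inv ij by (intro sum.cong) (auto simp: right_inv_def)
    finally show ?thesis
      using ij by (simp add: if_distrib[of "\<lambda>x. x * _"] cong: if_cong)
  qed
  have g: "gram beta (insert k S) b i l = gram beta S b i l + b k i * cnj (b k l)" for l
    using \<open>k \<notin> S\<close> \<open>finite S\<close> by (simp add: gram_def)
  have "(\<Sum>l<n. gram beta (insert k S) b i l * rank_one_update n G (b k) l j) =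
     (\<Sum>l<n. gram beta S b i l * G l j) + b k i * (\<Sum>l<n. cnj (b k l) * G l j)
     - (\<Sum>l<n. gram beta S b i l * v l) * (w j / (1 + q)) - b k i * (\<Sum>l<n. cnj (b k l) * v l) * (w j / (1 + q))"
    by (simp add: g rank_one_update_def flip: v_def w_def q_def)
      (simp add: algebra_simps sum.distrib sum_subtractf sum_distrib_left sum_distrib_right w_def add_divide_distrib flip: sum_divide_distrib)
  also have "\<dots> = (if i = j then 1 else 0) + b k i * w j - b k i * (w j / (1 + q)) - b k i * q * (w j / (1 + q))"
    unfolding qv Av using inv ij by (simp add: right_inv_def w_def)
  \<comment> \<open>The correction terms cancel since 1 - 1/(1+q) - q/(1+q) = 0.\<close>
  also have "b k i * w j - b k i * (w j / (1 + q)) - b k i * q * (w j / (1 + q)) = 0"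
    using q0 by (simp add: field_simps)
  then have "(if i = j then 1 else 0) + b k i * w j - b k i * (w j / (1 + q)) - b k i * q * (w j / (1 + q))
      = (if i = j then 1 else (0::complex))"
    by (simp add: algebra_simps)
  finally show "(\<Sum>l<n. gram beta (insert k S) b i l * rank_one_update n G (b k) l j) = (if i = j then 1 else 0)" .
qed

text \<open>Start from I/beta and add one vector at a time; each step is a Sherman-Morrison update,
  so no determinant or definiteness argument is involved.\<close>

lemma gram_inv_exists:
  assumes "finite S" "beta > 0"
  shows "\<exists>G. right_inv n (gram beta S b) G"
  using assms(1)
proof induction
  case empty
  have "right_inv n (gram beta {} b) (\<lambda>i j. if i = j then 1 / of_real beta else 0)"
    using assms(2) by (simp add: right_inv_def gram_def if_distrib[of "\<lambda>x. x * _"] cong: if_cong)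
  then show ?case by blast
next
  case (insert k S)
  then show ?case using sherman_morrison assms(2) by blast
qed

lemma right_inv_unique:
  assumes "right_inv n G A" "right_inv n A H" "i < n" "j < n"
  shows "G i j = H i j"
proof -
  have "G i j = (\<Sum>l<n. G i l * (if l = j then 1 else 0))"
    using \<open>j < n\<close> by (simp add: if_distrib cong: if_cong)
  also have "\<dots> = (\<Sum>l<n. G i l * (\<Sum>m<n. A l m * H m j))"
    using assms by (intro sum.cong) (auto simp: right_inv_def)
  also have "\<dots> = (\<Sum>m<n. (\<Sum>l<n. G i l * A l m) * H m j)"
    by (simp add: sum_distrib_left sum_distrib_right mult.assoc) (rule sum.swap)
  also have "\<dots> = (\<Sum>m<n. (if i = m then 1 else 0) * H m j)"
    using assms by (intro sum.cong) (auto simp: right_inv_def)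
  also have "\<dots> = H i j"
    using \<open>i < n\<close> by (simp add: if_distrib[of "\<lambda>x. x * _"] cong: if_cong)
  finally show ?thesis .
qed

lemma resolvent_right_inv:
  assumes "finite S" "beta > 0"
  shows "right_inv n (gram beta S b) (resolvent n beta S b)"
proof -
  define A where "A = mat n n (\<lambda>(i, j). gram beta S b i j)"
  obtain G where G: "right_inv n (gram beta S b) G"
    using gram_inv_exists assms by blast
  have G': "right_inv n G (gram beta S b)"
    by (rule right_inv_left_inv[OF cnj_gram G])
  have A: "A \<in> carrier_mat n n" by (simp add: A_def)
  have "A * mat n n (\<lambda>(i, j). G i j) = 1\<^sub>m n" "mat n n (\<lambda>(i, j). G i j) * A = 1\<^sub>m n"
    using G G' by (auto intro!: eq_matI simp: A_def right_inv_def scalar_prod_def atLeast0LessThan)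
  \<comment> \<open>The specification of \<open>mat_inverse\<close> speaks of units of the matrix
    ring, so a two-sided inverse has to be exhibited; its left half comes from Hermitian
    symmetry.\<close>
  then have "A \<in> Units (ring_mat TYPE(complex) n ())"
    using A by (auto simp: Units_def ring_mat_def intro!: bexI[of _ "mat n n (\<lambda>(i, j). G i j)"])
  then obtain B where B: "mat_inverse A = Some B"
    using mat_inverse(1)[OF A, where b = "()"] by (cases "mat_inverse A") auto
  then have AB: "A * B = 1\<^sub>m n" and Bc: "B \<in> carrier_mat n n"
    using mat_inverse(2)[OF A B] by auto
  have "(\<Sum>l<n. gram beta S b i l * B $$ (l, j)) = (if i = j then 1 else 0)" if "i < n" "j < n" for i j
  proof -
    have "(A * B) $$ (i, j) = (\<Sum>l<n. gram beta S b i l * B $$ (l, j))"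
      using that Bc by (simp add: A_def scalar_prod_def atLeast0LessThan)
    then show ?thesis using that by (simp add: AB)
  qed
  moreover have "resolvent n beta S b i j = B $$ (i, j)" for i j
    by (simp add: resolvent_def B flip: A_def)
  ultimately show ?thesis
    by (simp add: right_inv_def)
qed

lemma resolvent_insert:
  assumes "finite S" "beta > 0" "k \<notin> S" "i < n" "j < n"
  shows "resolvent n beta (insert k S) b i j = rank_one_update n (resolvent n beta S b) (b k) i j"
proof (rule right_inv_unique)
  show "right_inv n (resolvent n beta (insert k S) b) (gram beta (insert k S) b)"
    using assms by (intro right_inv_left_inv[OF cnj_gram] resolvent_right_inv) auto
  show "right_inv n (gram beta (insert k S) b) (rank_one_update n (resolvent n beta S b) (b k))"
    using assms by (intro sherman_morrison resolvent_right_inv) auto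
qed fact+

lemma resolvent_empty:
  assumes "beta > 0" "i < n" "j < n"
  shows "resolvent n beta {} b i j = (if i = j then 1 / of_real beta else 0)"
proof (rule right_inv_unique)
  show "right_inv n (resolvent n beta {} b) (gram beta {} b)"
    using assms by (intro right_inv_left_inv[OF cnj_gram] resolvent_right_inv) auto
  show "right_inv n (gram beta {} b) (\<lambda>i j. if i = j then 1 / of_real beta else 0)"
    using assms(1) by (simp add: right_inv_def gram_def if_distrib[of "\<lambda>x. x * _"] cong: if_cong)
qed fact+

text \<open>This is q - q^2/(1+q) = q/(1+q), in the form 1 - 1/(1+q) so that summing over the
  vectors splits off their number.\<close>

lemma qform_rank_one_update:
  assumes "1 + qform n G u \<noteq> 0"
  shows "qform n (rank_one_update n G u) u = 1 - 1 / (1 + qform n G u)"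
proof -
  define q where "q = qform n G u"
  define v where "v i = (\<Sum>l<n. G i l * u l)" for i
  define w where "w j = (\<Sum>l<n. cnj (u l) * G l j)" for j
  have qv: "(\<Sum>l<n. cnj (u l) * v l) = q"
    by (simp add: q_def qform_def v_def sum_distrib_left mult.assoc)
  have qw: "(\<Sum>l<n. w l * u l) = q"
    by (simp add: q_def qform_def w_def sum_distrib_right) (rule sum.swap)
  have "qform n (rank_one_update n G u) u = qform n G u - (\<Sum>i<n. \<Sum>j<n. cnj (u i) * v i * (w j * u j) / (1 + q))"
    unfolding qform_def[of _ "rank_one_update n G u"] rank_one_update_def
    by (simp flip: v_def w_def q_def) (simp add: q_def qform_def algebra_simps sum_subtractf)
  also have "(\<Sum>i<n. \<Sum>j<n. cnj (u i) * v i * (w j * u j) / (1 + q)) = q * q / (1 + q)"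
    by (simp add: qv qw sum_product flip: sum_divide_distrib) 
       (simp flip: sum_product add: qv qw)
  finally show ?thesis
    using assms by (simp add: q_def field_simps)
qed

lemma tr_resolvent_identity:
  assumes "finite S" "beta > 0"
  shows "beta * Re (tr n (resolvent n beta S b)) =
    real n - real (card S) + (\<Sum>k\<in>S. 1 / (1 + Re (qform n (resolvent n beta (S - {k}) b) (b k))))"
proof -
  define G where "G = resolvent n beta S b"
  note inv = resolvent_right_inv[OF assms, of n b, folded G_def]
  have q: "qform n G (b k) = of_real (1 - 1 / (1 + Re (qform n (resolvent n beta (S - {k}) b) (b k))))"
    if "k \<in> S" for k
  proof -
    define H where "H = resolvent n beta (S - {k}) b"
    have invH: "right_inv n (gram beta (S - {k}) b) H"
      unfolding H_def using assms by (intro resolvent_right_inv) auto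
    define r where "r = Re (qform n H (b k))"
    have r: "qform n H (b k) = of_real r" "r \<ge> 0"
      using qform_gram_inv_nonneg[OF invH \<open>beta > 0\<close>] by (auto simp: r_def)
    have r1: "1 + complex_of_real r \<noteq> 0"
      using r(2) by (simp add: complex_eq_iff)
    \<comment> \<open>\<open>S\<close> arises from \<open>S - {k}\<close> by inserting
      \<open>k\<close>, so \<open>G\<close> is an update of the resolvent that does not see the
      vector \<open>b k\<close>.\<close>
    have "qform n G (b k) = qform n (rank_one_update n H (b k)) (b k)"
      unfolding qform_def using assms resolvent_insert[of "S - {k}" beta k _ n _ b] that
      by (intro sum.cong refl) (simp add: G_def H_def insert_absorb)
    also have "\<dots> = of_real (1 - 1 / (1 + r))"
      using r1 by (subst qform_rank_one_update) (auto simp: r)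
    finally show ?thesis by (simp add: r_def H_def)
  qed
  have "of_nat n = (\<Sum>i<n. \<Sum>l<n. gram beta S b i l * G l i)"
    using inv by (simp add: right_inv_def)
  also have "\<dots> = (\<Sum>i<n. (\<Sum>k\<in>S. b k i * (\<Sum>l<n. cnj (b k l) * G l i)) + of_real beta * G i i)"
    by (intro sum.cong gram_apply) auto
  also have "\<dots> = (\<Sum>k\<in>S. \<Sum>i<n. \<Sum>l<n. cnj (b k l) * G l i * b k i) + of_real beta * tr n G"
    by (simp add: sum.distrib tr_def sum_distrib_left mult.commute mult.left_commute) (rule sum.swap)
  \<comment> \<open>The trace of b_k b_k^H G is the scalar b_k^H G b_k.\<close>
  also have "(\<Sum>k\<in>S. \<Sum>i<n. \<Sum>l<n. cnj (b k l) * G l i * b k i) = (\<Sum>k\<in>S. qform n G (b k))"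
    unfolding qform_def by (intro sum.cong refl sum.swap)
  also have "(\<Sum>k\<in>S. qform n G (b k)) =
      of_real (\<Sum>k\<in>S. 1 - 1 / (1 + Re (qform n (resolvent n beta (S - {k}) b) (b k))))"
    by (simp add: q)
  finally have "real n = (\<Sum>k\<in>S. 1 - 1 / (1 + Re (qform n (resolvent n beta (S - {k}) b) (b k)))) + beta * Re (tr n G)"
    by (simp add: complex_eq_iff)
  then show ?thesis
    by (simp add: sum_subtractf G_def)
qed

text \<open>The sum in the trace identity is nonnegative and is dropped. With fewer vectors than a
  fixed fraction of n this makes the trace of order n, whatever the vectors are.\<close>

lemma tr_resolvent_lower:
  assumes "finite S" "beta > 0"
  shows "(real n - real (card S)) / beta \<le> Re (tr n (resolvent n beta S b))"
proof -
  have "(\<Sum>k\<in>S. 1 / (1 + Re (qform n (resolvent n beta (S - {k}) b) (b k)))) \<ge> 0"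
    using assms by (intro sum_nonneg divide_nonneg_nonneg add_nonneg_nonneg qform_gram_inv_nonneg(2)[OF resolvent_right_inv]) auto
  then show ?thesis
    using tr_resolvent_identity[OF assms, of n b] \<open>beta > 0\<close> by (simp add: field_simps)
qed

section \<open>Fourth moments of quadratic forms\<close>

text \<open>A class closed under ring operations, so that integrability of any polynomial is read
  off its structure. Measurability is stated separately because powers of the absolute value do not
  determine the sign.\<close>

definition all_moments :: "'a measure \<Rightarrow> ('a \<Rightarrow> real) \<Rightarrow> bool" where
  "all_moments M f \<longleftrightarrow> f \<in> borel_measurable M \<and> (\<forall>k. integrable M (\<lambda>\<omega>. \<bar>f \<omega>\<bar> ^ k))"

lemma power_sum_le_powers:
  fixes x y :: real assumes "x \<ge> 0" "y \<ge> 0"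
  shows "(x + y) ^ k \<le> 2 ^ k * (x ^ k + y ^ k)"
proof -
  have "(x + y) ^ k \<le> (2 * max x y) ^ k"
    using assms by (intro power_mono) auto
  also have "\<dots> = 2 ^ k * max x y ^ k" by (simp add: power_mult_distrib)
  also have "max x y ^ k \<le> x ^ k + y ^ k"
    using assms by (auto simp: max_def)
  finally show ?thesis by simp
qed

lemma power4_sum_le: "(a + b) ^ 4 \<le> 8 * a ^ 4 + 8 * (b :: real) ^ 4"
proof -
  have "(a + b)\<^sup>2 \<le> 2 * a\<^sup>2 + 2 * b\<^sup>2"
    using sum_squares_bound[of a b] by (simp add: power2_sum)
  then have "((a + b)\<^sup>2)\<^sup>2 \<le> (2 * a\<^sup>2 + 2 * b\<^sup>2)\<^sup>2"
    by (intro power_mono) auto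
  also have "\<dots> \<le> 8 * (a\<^sup>2)\<^sup>2 + 8 * (b\<^sup>2)\<^sup>2"
    using sum_squares_bound[of "a\<^sup>2" "b\<^sup>2"] by (simp add: power2_sum power_mult_distrib)
  finally show ?thesis by simp
qed

section \<open>Calculus of moments in a probability space\<close>

context prob_space begin

lemma all_moments_const [intro]: "all_moments M (\<lambda>\<omega>. c)"
  by (simp add: all_moments_def)

lemma all_moments_add [intro]:
  assumes "all_moments M f" "all_moments M g" shows "all_moments M (\<lambda>\<omega>. f \<omega> + g \<omega>)"
  unfolding all_moments_def
proof (intro conjI allI)
  have [measurable]: "f \<in> borel_measurable M" "g \<in> borel_measurable M"
    using assms by (auto simp: all_moments_def)
  show "(\<lambda>\<omega>. f \<omega> + g \<omega>) \<in> borel_measurable M" by simp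
  fix k
  show "integrable M (\<lambda>\<omega>. \<bar>f \<omega> + g \<omega>\<bar> ^ k)"
  proof (rule Bochner_Integration.integrable_bound)
    show "integrable M (\<lambda>\<omega>. 2 ^ k * (\<bar>f \<omega>\<bar> ^ k + \<bar>g \<omega>\<bar> ^ k))"
      using assms by (auto simp: all_moments_def)
    have "\<bar>f \<omega> + g \<omega>\<bar> ^ k \<le> 2 ^ k * (\<bar>f \<omega>\<bar> ^ k + \<bar>g \<omega>\<bar> ^ k)" for \<omega>
      by (rule order_trans[OF power_mono[OF abs_triangle_ineq] power_sum_le_powers]) auto
    then show "AE \<omega> in M. norm (\<bar>f \<omega> + g \<omega>\<bar> ^ k) \<le> norm (2 ^ k * (\<bar>f \<omega>\<bar> ^ k + \<bar>g \<omega>\<bar> ^ k))"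
      by (auto simp: abs_of_nonneg)
  qed simp
qed

text \<open>By x y <= x^2 + y^2 a moment of a product costs twice the order in each factor; this is
  why all orders are demanded at once.\<close>

lemma all_moments_mult [intro]:
  assumes "all_moments M f" "all_moments M g" shows "all_moments M (\<lambda>\<omega>. f \<omega> * g \<omega>)"
  unfolding all_moments_def
proof (intro conjI allI)
  have [measurable]: "f \<in> borel_measurable M" "g \<in> borel_measurable M"
    using assms by (auto simp: all_moments_def)
  show "(\<lambda>\<omega>. f \<omega> * g \<omega>) \<in> borel_measurable M" by simp
  fix k
  show "integrable M (\<lambda>\<omega>. \<bar>f \<omega> * g \<omega>\<bar> ^ k)"
  proof (rule Bochner_Integration.integrable_bound)
    show "integrable M (\<lambda>\<omega>. \<bar>f \<omega>\<bar> ^ (k * 2) + \<bar>g \<omega>\<bar> ^ (k * 2))"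
      using assms by (intro Bochner_Integration.integrable_add) (simp_all add: all_moments_def)
    have "\<bar>f \<omega> * g \<omega>\<bar> ^ k \<le> \<bar>f \<omega>\<bar> ^ (k * 2) + \<bar>g \<omega>\<bar> ^ (k * 2)" for \<omega>
    proof -
      have "x * y \<le> x\<^sup>2 + y\<^sup>2" if "x \<ge> 0" "y \<ge> 0" for x y :: real
        using sum_squares_bound[of x y] mult_nonneg_nonneg[OF that] by linarith
      from this[of "\<bar>f \<omega>\<bar> ^ k" "\<bar>g \<omega>\<bar> ^ k"] show ?thesis
        by (simp add: abs_mult power_mult_distrib power_mult)
    qed
    then show "AE \<omega> in M. norm (\<bar>f \<omega> * g \<omega>\<bar> ^ k) \<le> norm (\<bar>f \<omega>\<bar> ^ (k * 2) + \<bar>g \<omega>\<bar> ^ (k * 2))"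
      by (auto simp: abs_of_nonneg)
  qed simp
qed

lemma all_moments_diff [intro]:
  assumes "all_moments M f" "all_moments M g" shows "all_moments M (\<lambda>\<omega>. f \<omega> - g \<omega>)"
proof -
  have "all_moments M (\<lambda>\<omega>. f \<omega> + (-1) * g \<omega>)"
    using assms by (intro all_moments_add all_moments_mult all_moments_const)
  then show ?thesis by simp
qed

lemma all_moments_power [intro]: "all_moments M f \<Longrightarrow> all_moments M (\<lambda>\<omega>. f \<omega> ^ k)"
  by (induction k) auto

lemma all_moments_sum [intro]:
  "(\<And>i. i \<in> I \<Longrightarrow> all_moments M (f i)) \<Longrightarrow> all_moments M (\<lambda>\<omega>. \<Sum>i\<in>I. f i \<omega>)"
  by (induction I rule: infinite_finite_induct) auto

lemma all_moments_integrable: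
  assumes "all_moments M f" shows "integrable M f"
proof -
  have [measurable]: "f \<in> borel_measurable M" using assms by (simp add: all_moments_def)
  have "integrable M (\<lambda>\<omega>. \<bar>f \<omega>\<bar> ^ 1)" using assms by (simp only: all_moments_def)
  then show ?thesis using integrable_abs_cancel[of M f] by simp
qed

text \<open>Cauchy-Schwarz is obtained from the AM-GM inequality with optimal weights, the weights being
  perturbed to avoid division by zero.\<close>

lemma expectation_squares_le:
  assumes "all_moments M f" "all_moments M g" "x \<ge> 0" "y \<ge> 0"
    and "expectation (\<lambda>\<omega>. f \<omega> ^ 4) \<le> x\<^sup>2" "expectation (\<lambda>\<omega>. g \<omega> ^ 4) \<le> y\<^sup>2"
  shows "expectation (\<lambda>\<omega>. (f \<omega>)\<^sup>2 * (g \<omega>)\<^sup>2) \<le> x * y"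
proof -
  have bound: "expectation (\<lambda>\<omega>. (f \<omega>)\<^sup>2 * (g \<omega>)\<^sup>2) \<le> (x + e) * (y + e)" if "e > 0" for e
  proof -
    define u where "u = x + e"
    define v where "v = y + e"
    have uv: "u > 0" "v > 0" using assms that by (auto simp: u_def v_def)
    have int: "integrable M (\<lambda>\<omega>. f \<omega> ^ 4)" "integrable M (\<lambda>\<omega>. g \<omega> ^ 4)"
      using assms by (auto intro!: all_moments_integrable)
    have "expectation (\<lambda>\<omega>. (f \<omega>)\<^sup>2 * (g \<omega>)\<^sup>2) \<le> expectation (\<lambda>\<omega>. v / u / 2 * f \<omega> ^ 4 + u / v / 2 * g \<omega> ^ 4)"
    proof (rule integral_mono)
      show "integrable M (\<lambda>\<omega>. (f \<omega>)\<^sup>2 * (g \<omega>)\<^sup>2)"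
        using assms by (auto intro!: all_moments_integrable)
      show "integrable M (\<lambda>\<omega>. v / u / 2 * f \<omega> ^ 4 + u / v / 2 * g \<omega> ^ 4)"
        using int by auto
      fix \<omega>
      have "0 \<le> (v * (f \<omega>)\<^sup>2 - u * (g \<omega>)\<^sup>2)\<^sup>2 / (2 * u * v)" using uv by simp
      also have "\<dots> = v / u / 2 * f \<omega> ^ 4 + u / v / 2 * g \<omega> ^ 4 - (f \<omega>)\<^sup>2 * (g \<omega>)\<^sup>2"
        using uv by (simp add: field_simps power2_eq_square power4_eq_xxxx)
      finally show "(f \<omega>)\<^sup>2 * (g \<omega>)\<^sup>2 \<le> v / u / 2 * f \<omega> ^ 4 + u / v / 2 * g \<omega> ^ 4" by simp
    qed
    also have "\<dots> = v / u / 2 * expectation (\<lambda>\<omega>. f \<omega> ^ 4) + u / v / 2 * expectation (\<lambda>\<omega>. g \<omega> ^ 4)"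
      using int by simp
    also have "\<dots> \<le> v / u / 2 * u\<^sup>2 + u / v / 2 * v\<^sup>2"
    proof -
      have "expectation (\<lambda>\<omega>. f \<omega> ^ 4) \<le> u\<^sup>2" "expectation (\<lambda>\<omega>. g \<omega> ^ 4) \<le> v\<^sup>2"
        using assms that by (auto simp: u_def v_def elim!: order_trans intro!: power_mono)
      then show ?thesis using uv by (intro add_mono mult_left_mono) auto
    qed
    also have "\<dots> = u * v" using uv by (simp add: field_simps power2_eq_square)
    finally show ?thesis by (simp add: u_def v_def)
  qed
  have "((\<lambda>e. (x + e) * (y + e)) \<longlongrightarrow> (x + 0) * (y + 0)) (at_right 0)"
    by (intro tendsto_intros)
  then show ?thesis
    by (intro tendsto_lowerbound[where F = "at_right 0"]) (auto simp: eventually_at_right_less intro!: eventually_at_rightI[of 0 1] bound)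
qed

text \<open>The vanishing of the cubic cross term is what makes the square root of the fourth moment
  grow only additively, as it would for a martingale.\<close>

lemma fourth_moment_add:
  assumes "all_moments M Q" "all_moments M D" "x \<ge> 0" "d \<ge> 0"
    and Q: "expectation (\<lambda>\<omega>. Q \<omega> ^ 4) \<le> x\<^sup>2" and D: "expectation (\<lambda>\<omega>. D \<omega> ^ 4) \<le> d\<^sup>2"
    and QD: "expectation (\<lambda>\<omega>. Q \<omega> ^ 3 * D \<omega>) = 0"
  shows "expectation (\<lambda>\<omega>. (Q \<omega> + D \<omega>) ^ 4) \<le> (x + 4 * d)\<^sup>2"
proof -
  have int: "integrable M (\<lambda>\<omega>. Q \<omega> ^ 4)" "integrable M (\<lambda>\<omega>. D \<omega> ^ 4)"
    "integrable M (\<lambda>\<omega>. Q \<omega> ^ 3 * D \<omega>)" "integrable M (\<lambda>\<omega>. (Q \<omega>)\<^sup>2 * (D \<omega>)\<^sup>2)"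
    using assms by (auto intro!: all_moments_integrable)
  have "expectation (\<lambda>\<omega>. (Q \<omega> + D \<omega>) ^ 4) \<le>
      expectation (\<lambda>\<omega>. Q \<omega> ^ 4 + 4 * (Q \<omega> ^ 3 * D \<omega>) + 8 * ((Q \<omega>)\<^sup>2 * (D \<omega>)\<^sup>2) + 3 * D \<omega> ^ 4)"
  proof (rule integral_mono)
    show "integrable M (\<lambda>\<omega>. (Q \<omega> + D \<omega>) ^ 4)"
      using assms by (auto intro!: all_moments_integrable)
    show "integrable M (\<lambda>\<omega>. Q \<omega> ^ 4 + 4 * (Q \<omega> ^ 3 * D \<omega>) + 8 * ((Q \<omega>)\<^sup>2 * (D \<omega>)\<^sup>2) + 3 * D \<omega> ^ 4)"
      using int by auto
    fix \<omega>
    \<comment> \<open>The odd term 4 Q D^3 is absorbed by enlarging 6 Q^2 D^2 to 8 Q^2 D^2 and D^4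
      to 3 D^4; the surplus is this square.\<close>
    have "0 \<le> 2 * (D \<omega> * (Q \<omega> - D \<omega>))\<^sup>2" by simp
    also have "\<dots> = Q \<omega> ^ 4 + 4 * (Q \<omega> ^ 3 * D \<omega>) + 8 * ((Q \<omega>)\<^sup>2 * (D \<omega>)\<^sup>2) + 3 * D \<omega> ^ 4 - (Q \<omega> + D \<omega>) ^ 4"
      by (simp add: algebra_simps power2_eq_square power4_eq_xxxx power3_eq_cube)
    finally show "(Q \<omega> + D \<omega>) ^ 4 \<le> Q \<omega> ^ 4 + 4 * (Q \<omega> ^ 3 * D \<omega>) + 8 * ((Q \<omega>)\<^sup>2 * (D \<omega>)\<^sup>2) + 3 * D \<omega> ^ 4"
      by simp
  qed
  also have "\<dots> = expectation (\<lambda>\<omega>. Q \<omega> ^ 4) + 8 * expectation (\<lambda>\<omega>. (Q \<omega>)\<^sup>2 * (D \<omega>)\<^sup>2) + 3 * expectation (\<lambda>\<omega>. D \<omega> ^ 4)"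
    using int QD by simp
  also have "\<dots> \<le> x\<^sup>2 + 8 * (x * d) + 3 * d\<^sup>2"
    using expectation_squares_le[OF assms(1-4) Q D] Q D by linarith
  \<comment> \<open>The factor 4 is chosen to reproduce the mixed term 8 x d exactly.\<close>
  also have "\<dots> \<le> (x + 4 * d)\<^sup>2"
    by (simp add: power2_eq_square algebra_simps)
  finally show ?thesis .
qed

text \<open>One coordinate against a function of all the others. The function takes the restricted
  family because the independence statement lives on a product space; for functions that look only
  at \<open>J\<close> the restriction disappears on simplification.\<close>

lemma indep_vars_expectation_mult:
  fixes X :: "'i \<Rightarrow> 'a \<Rightarrow> real" and h :: "('i \<Rightarrow> real) \<Rightarrow> real"
  assumes ind: "indep_vars (\<lambda>_. borel) X I" and "p \<in> I" "J \<subseteq> I" "p \<notin> J"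
    and f: "f \<in> borel_measurable borel" and h: "h \<in> borel_measurable (PiM J (\<lambda>_. borel))"
    and "integrable M (\<lambda>\<omega>. f (X p \<omega>))" "integrable M (\<lambda>\<omega>. h (\<lambda>q\<in>J. X q \<omega>))"
  shows "expectation (\<lambda>\<omega>. f (X p \<omega>) * h (\<lambda>q\<in>J. X q \<omega>))
    = expectation (\<lambda>\<omega>. f (X p \<omega>)) * expectation (\<lambda>\<omega>. h (\<lambda>q\<in>J. X q \<omega>))"
proof (rule indep_var_lebesgue_integral)
  have "indep_var (PiM {p} (\<lambda>_. borel)) (\<lambda>\<omega>. restrict (\<lambda>i. X i \<omega>) {p})
      (PiM J (\<lambda>_. borel)) (\<lambda>\<omega>. restrict (\<lambda>i. X i \<omega>) J)"
    using assms by (intro indep_var_restrict[OF ind]) auto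
  from indep_var_compose[OF this, of "\<lambda>y. f (y p)" borel h borel]
  show "indep_var borel (\<lambda>\<omega>. f (X p \<omega>)) borel (\<lambda>\<omega>. h (\<lambda>q\<in>J. X q \<omega>))"
    using f h by (simp add: comp_def measurable_compose[OF measurable_component_singleton])
qed fact+

text \<open>Coordinates are added one by one. The cubic cross term contains the new coordinate to
  the first power, so it factors by independence and vanishes with the mean.\<close>

lemma fourth_moment_linear_form:
  fixes X :: "'i \<Rightarrow> 'a \<Rightarrow> real"
  assumes ind: "indep_vars (\<lambda>_. borel) X I" and "finite J" "J \<subseteq> I" "m \<ge> 0"
    and mom: "\<And>p. p \<in> I \<Longrightarrow> all_moments M (X p)"
    and mean: "\<And>p. p \<in> I \<Longrightarrow> expectation (X p) = 0"
    and fourth: "\<And>p. p \<in> I \<Longrightarrow> expectation (\<lambda>\<omega>. X p \<omega> ^ 4) \<le> m\<^sup>2"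
  shows "expectation (\<lambda>\<omega>. (\<Sum>q\<in>J. c q * X q \<omega>) ^ 4) \<le> (4 * m * (\<Sum>q\<in>J. (c q)\<^sup>2))\<^sup>2"
  using \<open>finite J\<close> \<open>J \<subseteq> I\<close>
proof (induction J)
  case (insert p J)
  define u where "u \<omega> = (\<Sum>q\<in>J. c q * X q \<omega>)" for \<omega>
  have u': "all_moments M (\<lambda>\<omega>. \<Sum>q\<in>J. c q * X q \<omega>)"
    using insert mom by (intro all_moments_sum all_moments_mult) auto
  then have u: "all_moments M u" by (simp add: u_def[abs_def])
  have p: "all_moments M (X p)" using insert mom by auto
  have "expectation (\<lambda>\<omega>. X p \<omega> * (\<lambda>y. (\<Sum>q\<in>J. c q * y q) ^ 3) (\<lambda>q\<in>J. X q \<omega>))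
      = expectation (\<lambda>\<omega>. X p \<omega>) * expectation (\<lambda>\<omega>. (\<lambda>y. (\<Sum>q\<in>J. c q * y q) ^ 3) (\<lambda>q\<in>J. X q \<omega>))"
    using insert p u' by (intro indep_vars_expectation_mult[OF ind]) (auto intro!: all_moments_integrable)
  then have "expectation (\<lambda>\<omega>. X p \<omega> * u \<omega> ^ 3) = 0"
    using insert mean by (simp add: u_def)
  moreover have "u \<omega> ^ 3 * (c p * X p \<omega>) = c p * (X p \<omega> * u \<omega> ^ 3)" for \<omega>
    by simp
  ultimately have cross: "expectation (\<lambda>\<omega>. u \<omega> ^ 3 * (c p * X p \<omega>)) = 0"
    by (simp only: integral_mult_right_zero mult_zero_right)
  have "expectation (\<lambda>\<omega>. (u \<omega> + c p * X p \<omega>) ^ 4) \<le> (4 * m * (\<Sum>q\<in>J. (c q)\<^sup>2) + 4 * (m * (c p)\<^sup>2))\<^sup>2"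
  proof (rule fourth_moment_add[OF u _ _ _ _ _ cross])
    show "all_moments M (\<lambda>\<omega>. c p * X p \<omega>)" using p by auto
    show "expectation (\<lambda>\<omega>. u \<omega> ^ 4) \<le> (4 * m * (\<Sum>q\<in>J. (c q)\<^sup>2))\<^sup>2"
      using insert by (simp add: u_def)
    have "expectation (\<lambda>\<omega>. (c p * X p \<omega>) ^ 4) = c p ^ 4 * expectation (\<lambda>\<omega>. X p \<omega> ^ 4)"
      by (simp add: power_mult_distrib)
    also have "\<dots> \<le> c p ^ 4 * m\<^sup>2"
      using fourth insert by (intro mult_left_mono) auto
    also have "\<dots> = (m * (c p)\<^sup>2)\<^sup>2" by (simp add: power_mult_distrib)
    finally show "expectation (\<lambda>\<omega>. (c p * X p \<omega>) ^ 4) \<le> (m * (c p)\<^sup>2)\<^sup>2" .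
  qed (use \<open>m \<ge> 0\<close> in \<open>auto intro!: mult_nonneg_nonneg sum_nonneg\<close>)
  then show ?case
    using insert by (simp add: u_def algebra_simps)
qed auto

text \<open>Adding the index p changes the centered form Q by D = S_pp (X_p^2 - s) + 2 X_p u, with u
  linear in the earlier coordinates. Both parts of D have mean zero given those coordinates, so
  E[Q^3 D] = 0, and the fourth moment of D is bounded by the row bound alone. The square root of the
  fourth moment therefore grows linearly in the number of coordinates.\<close>

lemma fourth_moment_quadratic_form:
  fixes X :: "'i \<Rightarrow> 'a \<Rightarrow> real"
  assumes ind: "indep_vars (\<lambda>_. borel) X I" and "finite J" "J \<subseteq> I" "finite I" "s \<ge> 0"
    and mom: "\<And>p. p \<in> I \<Longrightarrow> all_moments M (X p)"
    and mean: "\<And>p. p \<in> I \<Longrightarrow> expectation (X p) = 0"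
    and var: "\<And>p. p \<in> I \<Longrightarrow> expectation (\<lambda>\<omega>. (X p \<omega>)\<^sup>2) = s"
    and fourth: "\<And>p. p \<in> I \<Longrightarrow> expectation (\<lambda>\<omega>. X p \<omega> ^ 4) = 3 * s\<^sup>2"
    and eighth: "\<And>p. p \<in> I \<Longrightarrow> expectation (\<lambda>\<omega>. X p \<omega> ^ 8) = 105 * s ^ 4"
    and sym: "\<And>p q. p \<in> I \<Longrightarrow> q \<in> I \<Longrightarrow> S p q = S q p"
    and row: "\<And>p. p \<in> I \<Longrightarrow> (\<Sum>q\<in>I. (S p q)\<^sup>2) \<le> r"
  shows "expectation (\<lambda>\<omega>. ((\<Sum>p\<in>J. \<Sum>q\<in>J. S p q * X p \<omega> * X q \<omega>) - s * (\<Sum>p\<in>J. S p p)) ^ 4)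
    \<le> (712 * s\<^sup>2 * r * real (card J))\<^sup>2"
  using \<open>finite J\<close> \<open>J \<subseteq> I\<close>
proof (induction J)
  case (insert p J)
  define qf where "qf y = (\<Sum>p\<in>J. \<Sum>q\<in>J. S p q * y p * y q) - s * (\<Sum>p\<in>J. S p p)" for y
  define lf where "lf y = (\<Sum>q\<in>J. S p q * y q)" for y
  define Q where "Q \<omega> = qf (\<lambda>q. X q \<omega>)" for \<omega>
  define u where "u \<omega> = lf (\<lambda>q. X q \<omega>)" for \<omega>
  define D where "D \<omega> = S p p * ((X p \<omega>)\<^sup>2 - s) + 2 * (X p \<omega> * u \<omega>)" for \<omega>
  have pI: "p \<in> I" and JI: "J \<subseteq> I" "p \<notin> J" using insert by auto
  have restr: "qf (\<lambda>q\<in>J. X q \<omega>) = Q \<omega>" "lf (\<lambda>q\<in>J. X q \<omega>) = u \<omega>" for \<omega>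
    by (simp_all add: qf_def lf_def Q_def u_def)
  have [measurable]: "qf \<in> borel_measurable (PiM J (\<lambda>_. borel))" "lf \<in> borel_measurable (PiM J (\<lambda>_. borel))"
    unfolding qf_def lf_def by measurable
  have u: "all_moments M u"
    unfolding u_def lf_def using JI mom by (intro all_moments_sum all_moments_mult) auto
  have Q: "all_moments M Q"
    unfolding Q_def qf_def using JI mom
    by (intro all_moments_sum all_moments_mult all_moments_diff all_moments_const) auto
  have p: "all_moments M (X p)" using pI mom by auto
  have D: "all_moments M D"
    unfolding D_def using p u
    by (intro all_moments_add all_moments_mult all_moments_diff all_moments_const all_moments_power)
  have r0: "r \<ge> 0"
    using row[OF pI] by (rule order_trans[rotated]) (auto intro: sum_nonneg)
  have Spp: "(S p p)\<^sup>2 \<le> r"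
    using row[OF pI] member_le_sum[of p I "\<lambda>q. (S p q)\<^sup>2"] pI \<open>finite I\<close> by auto
  note all_moments_intros = all_moments_mult all_moments_diff all_moments_power all_moments_const
  have ints: "integrable M (\<lambda>\<omega>. (X p \<omega>)\<^sup>2 - s)" "integrable M (\<lambda>\<omega>. Q \<omega> ^ 3)"
      "integrable M (\<lambda>\<omega>. X p \<omega>)" "integrable M (\<lambda>\<omega>. u \<omega> * Q \<omega> ^ 3)"
      "integrable M (\<lambda>\<omega>. X p \<omega> ^ 4)" "integrable M (\<lambda>\<omega>. u \<omega> ^ 4)"
    by (intro all_moments_integrable all_moments_intros p u Q)+
  have "expectation (\<lambda>\<omega>. ((X p \<omega>)\<^sup>2 - s) * Q \<omega> ^ 3) = expectation (\<lambda>\<omega>. (X p \<omega>)\<^sup>2 - s) * expectation (\<lambda>\<omega>. Q \<omega> ^ 3)"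
    using indep_vars_expectation_mult[OF ind pI JI, of "\<lambda>x. x\<^sup>2 - s" "\<lambda>y. qf y ^ 3"] ints
    by (simp add: restr)
  also have "expectation (\<lambda>\<omega>. (X p \<omega>)\<^sup>2 - s) = 0"
  proof -
    have "integrable M (\<lambda>\<omega>. (X p \<omega>)\<^sup>2)" using p by (auto intro!: all_moments_integrable)
    then show ?thesis using var[OF pI] by (simp add: prob_space)
  qed
  finally have c1: "expectation (\<lambda>\<omega>. ((X p \<omega>)\<^sup>2 - s) * Q \<omega> ^ 3) = 0" by simp
  have c2: "expectation (\<lambda>\<omega>. X p \<omega> * (u \<omega> * Q \<omega> ^ 3)) = 0"
    using indep_vars_expectation_mult[OF ind pI JI, of "\<lambda>x. x" "\<lambda>y. lf y * qf y ^ 3"] ints mean[OF pI]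
    by (simp add: restr)
  have "expectation (\<lambda>\<omega>. Q \<omega> ^ 3 * D \<omega>) =
     expectation (\<lambda>\<omega>. S p p * (((X p \<omega>)\<^sup>2 - s) * Q \<omega> ^ 3) + 2 * (X p \<omega> * (u \<omega> * Q \<omega> ^ 3)))"
    by (simp add: D_def algebra_simps)
  also have "\<dots> = S p p * expectation (\<lambda>\<omega>. ((X p \<omega>)\<^sup>2 - s) * Q \<omega> ^ 3) + 2 * expectation (\<lambda>\<omega>. X p \<omega> * (u \<omega> * Q \<omega> ^ 3))"
  proof -
    have "integrable M (\<lambda>\<omega>. ((X p \<omega>)\<^sup>2 - s) * Q \<omega> ^ 3)" "integrable M (\<lambda>\<omega>. X p \<omega> * (u \<omega> * Q \<omega> ^ 3))"
      by (intro all_moments_integrable all_moments_intros p u Q)+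
    then show ?thesis by simp
  qed
  finally have cross: "expectation (\<lambda>\<omega>. Q \<omega> ^ 3 * D \<omega>) = 0" by (simp add: c1 c2)
  \<comment> \<open>The linear bound is applied with m = 2 s, since the fourth moment 3 s^2 is at
    most (2 s)^2.\<close>
  have "expectation (\<lambda>\<omega>. u \<omega> ^ 4) \<le> (4 * (2 * s) * (\<Sum>q\<in>J. (S p q)\<^sup>2))\<^sup>2"
    unfolding u_def lf_def
    using insert.hyps JI mom mean \<open>s \<ge> 0\<close> by (intro fourth_moment_linear_form[OF ind]) (auto simp: fourth power2_eq_square)
  also have "\<dots> \<le> (4 * (2 * s) * r)\<^sup>2"
  proof -
    have "(\<Sum>q\<in>J. (S p q)\<^sup>2) \<le> r"
      using row[OF pI] sum_mono2[OF \<open>finite I\<close> JI(1), of "\<lambda>q. (S p q)\<^sup>2"] by auto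
    then show ?thesis
      using \<open>s \<ge> 0\<close> by (intro power_mono mult_left_mono mult_nonneg_nonneg sum_nonneg) auto
  qed
  finally have u4: "expectation (\<lambda>\<omega>. u \<omega> ^ 4) \<le> 64 * s\<^sup>2 * r\<^sup>2"
    by (simp add: power_mult_distrib)
  have Xu: "expectation (\<lambda>\<omega>. X p \<omega> ^ 4 * u \<omega> ^ 4) = 3 * s\<^sup>2 * expectation (\<lambda>\<omega>. u \<omega> ^ 4)"
    using indep_vars_expectation_mult[OF ind pI JI, of "\<lambda>x. x ^ 4" "\<lambda>y. lf y ^ 4"] ints fourth[OF pI]
    by (simp add: restr)
  have i8: "integrable M (\<lambda>\<omega>. X p \<omega> ^ 8)" and iXu: "integrable M (\<lambda>\<omega>. X p \<omega> ^ 4 * u \<omega> ^ 4)"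
    by (intro all_moments_integrable all_moments_intros p u)+
  have D4: "D \<omega> ^ 4 \<le> 64 * S p p ^ 4 * (X p \<omega> ^ 8 + s ^ 4) + 128 * (X p \<omega> ^ 4 * u \<omega> ^ 4)" for \<omega>
  proof -
    have "D \<omega> ^ 4 \<le> 8 * (S p p * ((X p \<omega>)\<^sup>2 + - s)) ^ 4 + 8 * (2 * (X p \<omega> * u \<omega>)) ^ 4"
      unfolding D_def using power4_sum_le[of "S p p * ((X p \<omega>)\<^sup>2 - s)" "2 * (X p \<omega> * u \<omega>)"] by simp
    also have "\<dots> = 8 * S p p ^ 4 * ((X p \<omega>)\<^sup>2 + - s) ^ 4 + 128 * (X p \<omega> ^ 4 * u \<omega> ^ 4)"
      by (simp add: power_mult_distrib)
    also have "\<dots> \<le> 8 * S p p ^ 4 * (8 * ((X p \<omega>)\<^sup>2) ^ 4 + 8 * (- s) ^ 4) + 128 * (X p \<omega> ^ 4 * u \<omega> ^ 4)"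
      by (intro add_right_mono mult_left_mono power4_sum_le) auto
    finally show ?thesis by (simp add: algebra_simps)
  qed
  have "expectation (\<lambda>\<omega>. D \<omega> ^ 4) \<le>
     expectation (\<lambda>\<omega>. 64 * S p p ^ 4 * (X p \<omega> ^ 8 + s ^ 4) + 128 * (X p \<omega> ^ 4 * u \<omega> ^ 4))"
    using D i8 iXu D4 by (intro integral_mono) (auto intro!: all_moments_integrable)
  also have "\<dots> = 64 * S p p ^ 4 * (105 * s ^ 4 + s ^ 4) + 128 * (3 * s\<^sup>2 * expectation (\<lambda>\<omega>. u \<omega> ^ 4))"
    using i8 iXu by (simp add: Xu eighth[OF pI] prob_space)
  also have "\<dots> \<le> 64 * r\<^sup>2 * (105 * s ^ 4 + s ^ 4) + 128 * (3 * s\<^sup>2 * (64 * s\<^sup>2 * r\<^sup>2))"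
  proof -
    have "S p p ^ 4 = ((S p p)\<^sup>2)\<^sup>2" by simp
    also have "\<dots> \<le> r\<^sup>2" using Spp by (intro power_mono) auto
    finally show ?thesis
      using u4 \<open>s \<ge> 0\<close> by (intro add_mono mult_left_mono mult_right_mono) auto
  qed
  also have "\<dots> = 31360 * (s\<^sup>2 * r)\<^sup>2"
    by (simp add: power_mult_distrib algebra_simps flip: power_add)
  \<comment> \<open>Here 31360 = 64 * 106 + 128 * 3 * 64, and 178 is the least integer whose square
    exceeds it; \<open>fourth_moment_add\<close> multiplies it by 4, which gives 712.\<close>
  also have "\<dots> \<le> (178 * s\<^sup>2 * r)\<^sup>2"
    by (simp add: power_mult_distrib)
  finally have D4E: "expectation (\<lambda>\<omega>. D \<omega> ^ 4) \<le> (178 * s\<^sup>2 * r)\<^sup>2" .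
  have "expectation (\<lambda>\<omega>. (Q \<omega> + D \<omega>) ^ 4) \<le> (712 * s\<^sup>2 * r * real (card J) + 4 * (178 * s\<^sup>2 * r))\<^sup>2"
    using insert.IH[OF JI(1)] r0 by (intro fourth_moment_add[OF Q D _ _ _ D4E cross]) (auto simp: Q_def qf_def)
  moreover have "(\<Sum>p'\<in>insert p J. \<Sum>q\<in>insert p J. S p' q * X p' \<omega> * X q \<omega>) - s * (\<Sum>p\<in>insert p J. S p p)
       = Q \<omega> + D \<omega>" for \<omega>
  proof -
    \<comment> \<open>Symmetry merges the new row and the new column into the single term 2 X_p
      u.\<close>
    have "(\<Sum>q\<in>J. S q p * X q \<omega> * X p \<omega>) = (\<Sum>q\<in>J. S p q * X p \<omega> * X q \<omega>)"
      using JI pI sym by (intro sum.cong) (auto simp: mult.commute mult.left_commute)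
    then show ?thesis
      using insert.hyps
      by (simp add: sum.distrib Q_def qf_def D_def u_def lf_def algebra_simps power2_eq_square flip: sum_distrib_left)
        (simp add: sum_distrib_left mult_ac)
  qed
  ultimately show ?case
    using insert.hyps by (simp add: algebra_simps)
qed auto

end

section \<open>Quadratic forms in complex Gaussian vectors\<close>

lemma (in prob_space) centered_normal_moments:
  assumes dist: "distributed M lborel Y (\<lambda>x. ennreal (normal_density 0 sd x))" and "sd > 0"
  shows "all_moments M Y" "expectation Y = 0" "expectation (\<lambda>\<omega>. (Y \<omega>)\<^sup>2) = sd\<^sup>2"
    "expectation (\<lambda>\<omega>. Y \<omega> ^ 4) = 3 * (sd\<^sup>2)\<^sup>2" "expectation (\<lambda>\<omega>. Y \<omega> ^ 8) = 105 * (sd\<^sup>2) ^ 4"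
proof -
  have [measurable]: "Y \<in> borel_measurable M"
    using distributed_measurable[OF dist] by simp
  have "integrable M (\<lambda>\<omega>. \<bar>Y \<omega>\<bar> ^ k)" for k
    using distributed_integrable[OF dist, of "\<lambda>x. \<bar>x\<bar> ^ k"] integrable_normal_moment_abs[OF \<open>sd > 0\<close>, of 0 k] by simp
  then show "all_moments M Y" by (simp add: all_moments_def)
  have ev: "expectation (\<lambda>\<omega>. Y \<omega> ^ (2 * k)) = fact (2 * k) / ((2 / sd\<^sup>2) ^ k * fact k)" for k
    using distributed_integral[OF dist, of "\<lambda>x. x ^ (2 * k)"] integral_normal_moment_even[OF \<open>sd > 0\<close>, of 0 k] by simp
  show "expectation Y = 0"
    using distributed_integral[OF dist, of "\<lambda>x. x"] integral_normal_moment_nz_1[OF \<open>sd > 0\<close>, of 0] by simp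
  show "expectation (\<lambda>\<omega>. (Y \<omega>)\<^sup>2) = sd\<^sup>2"
    using ev[of 1] by (simp add: fact_numeral)
  show "expectation (\<lambda>\<omega>. Y \<omega> ^ 4) = 3 * (sd\<^sup>2)\<^sup>2"
    using ev[of 2] by (simp add: fact_numeral power_divide)
  \<comment> \<open>The eighth moment is called for by (X_p^2 - s)^4; 3 and 105 are the double
    factorials of 3 and 7.\<close>
  show "expectation (\<lambda>\<omega>. Y \<omega> ^ 8) = 105 * (sd\<^sup>2) ^ 4"
    using ev[of 4] by (simp add: fact_numeral power_divide)
qed

lemma sum_coordinates:
  "sum f ({k} \<times> {..<n} \<times> (UNIV :: bool set)) = (\<Sum>i<n. f (k, i, True) + f (k, i, False))"
proof -
  have "sum f ({k} \<times> {..<n} \<times> (UNIV :: bool set)) = (\<Sum>k'\<in>{k}. \<Sum>i<n. \<Sum>r\<in>UNIV. f (k', i, r))"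
    by (simp only: sum.cartesian_product) (simp add: case_prod_unfold)
  then show ?thesis by (simp add: UNIV_bool add.commute)
qed

text \<open>A Hermitian form in n complex variables is a real symmetric form in 2n real ones, each
  of variance \<open>v k / 2\<close>. The bound is on a nonnegative integral so that it can serve as
  the inner integral of an iterated one.\<close>

lemma (in prob_space) fourth_moment_complex_gaussian_form:
  assumes CN: "indep_CN_vectors M n K v X" and k: "k \<in> {1..K}" and "v k > 0"
    and herm: "\<And>i j. i < n \<Longrightarrow> j < n \<Longrightarrow> cnj (G j i) = G i j"
    and row: "\<And>i. i < n \<Longrightarrow> (\<Sum>j<n. (cmod (G i j))\<^sup>2) \<le> r"
  shows "(\<integral>\<^sup>+\<omega>. ennreal ((Re (qform n G (X k \<omega>)) - v k * Re (tr n G)) ^ 4) \<partial>M)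
    \<le> ennreal ((356 * (v k)\<^sup>2 * r * real n)\<^sup>2)"
proof -
  define x where "x = (\<lambda>(k::nat, i::nat, re). \<lambda>\<omega>. if re then Re (X k \<omega> i) else Im (X k \<omega> i))"
  define I where "I = {k} \<times> {..<n} \<times> (UNIV :: bool set)"
  define s where "s = v k / 2"
  \<comment> \<open>The real block matrix with rows (Re G, -Im G) and (Im G, Re G). Each of its rows
    has the norm of the corresponding complex row, and its trace is twice that of \<open>G\<close>,
    which cancels the half in \<open>s\<close>.\<close>
  define S where "S = (\<lambda>(_::nat, i, re) (_::nat, j, re').
      if re = re' then Re (G i j) else if re then - Im (G i j) else Im (G i j))"
  have ind: "indep_vars (\<lambda>_. borel) x I"
    using CN k unfolding indep_CN_vectors_def x_def I_def by (auto elim!: indep_vars_subset)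
  have I: "finite I" "card I = 2 * n" by (auto simp: I_def card_cartesian_product)
  have sd: "sqrt (v k / 2) > 0" "(sqrt (v k / 2))\<^sup>2 = s" "s \<ge> 0" using \<open>v k > 0\<close> by (auto simp: s_def)
  have dist: "distributed M lborel (x p) (\<lambda>y. ennreal (normal_density 0 (sqrt (v k / 2)) y))" if p: "p \<in> I" for p
  proof -
    obtain i re where "p = (k, i, re)" "i < n" using p by (auto simp: I_def)
    then show ?thesis using CN k by (cases re) (simp_all add: indep_CN_vectors_def x_def)
  qed
  note mom = centered_normal_moments[OF dist sd(1), unfolded sd(2)]
  define Q where "Q \<omega> = (\<Sum>p\<in>I. \<Sum>q\<in>I. S p q * x p \<omega> * x q \<omega>) - s * (\<Sum>p\<in>I. S p p)" for \<omega>
  have "expectation (\<lambda>\<omega>. Q \<omega> ^ 4) \<le> (712 * s\<^sup>2 * r * real (card I))\<^sup>2"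
    unfolding Q_def
  proof (rule fourth_moment_quadratic_form[OF ind I(1) order_refl I(1) sd(3) mom])
    show "S p q = S q p" if "p \<in> I" "q \<in> I" for p q
      using that herm by (auto simp: S_def I_def complex_eq_iff split: prod.splits)
    show "(\<Sum>q\<in>I. (S p q)\<^sup>2) \<le> r" if pI: "p \<in> I" for p
    proof -
      obtain i re where p: "p = (k, i, re)" "i < n" using pI by (auto simp: I_def)
      have "(\<Sum>q\<in>I. (S p q)\<^sup>2) = (\<Sum>j<n. (cmod (G i j))\<^sup>2)"
        unfolding I_def sum_coordinates by (cases re) (auto simp: p S_def cmod_power2 intro!: sum.cong)
      then show ?thesis using row[OF p(2)] by simp
    qed
  qed
  \<comment> \<open>The constant is 712 / 4 from the halved variance, times 2 for the 2n
    coordinates.\<close>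
  also have "712 * s\<^sup>2 * r * real (card I) = 356 * (v k)\<^sup>2 * r * real n"
    by (simp add: I s_def power_divide)
  finally have bound: "expectation (\<lambda>\<omega>. Q \<omega> ^ 4) \<le> (356 * (v k)\<^sup>2 * r * real n)\<^sup>2" .
  have "all_moments M Q"
    unfolding Q_def using mom(1)
    by (intro all_moments_sum all_moments_mult all_moments_diff all_moments_const) auto
  then have int: "integrable M (\<lambda>\<omega>. Q \<omega> ^ 4)"
    by (intro all_moments_integrable all_moments_power)
  have "Re (qform n G (X k \<omega>)) - v k * Re (tr n G) = Q \<omega>" for \<omega>
  proof -
    have "(\<Sum>p\<in>I. \<Sum>q\<in>I. S p q * x p \<omega> * x q \<omega>) = Re (qform n G (X k \<omega>))"
      unfolding I_def sum_coordinates qform_def Re_sum sum.distrib[symmetric]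
      by (intro sum.cong refl) (simp add: S_def x_def algebra_simps)
    moreover have "(\<Sum>p\<in>I. S p p) = 2 * Re (tr n G)"
      unfolding I_def sum_coordinates by (simp add: S_def tr_def sum_distrib_left)
    ultimately show ?thesis by (simp add: Q_def s_def)
  qed
  then have "(\<integral>\<^sup>+\<omega>. ennreal ((Re (qform n G (X k \<omega>)) - v k * Re (tr n G)) ^ 4) \<partial>M) = (\<integral>\<^sup>+\<omega>. ennreal (Q \<omega> ^ 4) \<partial>M)"
    by simp
  also have "\<dots> = ennreal (expectation (\<lambda>\<omega>. Q \<omega> ^ 4))"
    by (rule nn_integral_eq_integral[OF int]) auto
  also have "\<dots> \<le> ennreal ((356 * (v k)\<^sup>2 * r * real n)\<^sup>2)"
    using bound by (rule ennreal_leI)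
  finally show ?thesis .
qed

section \<open>Measurability, and forms in a vector independent of the matrix\<close>

lemma borel_measurable_cnj [measurable]: "cnj \<in> borel_measurable borel"
  by (intro borel_measurable_continuous_onI continuous_intros)

lemma borel_measurable_qform:
  assumes "\<And>i j. i < n \<Longrightarrow> j < n \<Longrightarrow> (\<lambda>\<omega>. G \<omega> i j) \<in> borel_measurable N"
    and "\<And>i. i < n \<Longrightarrow> (\<lambda>\<omega>. u \<omega> i) \<in> borel_measurable N"
  shows "(\<lambda>\<omega>. qform n (G \<omega>) (u \<omega>)) \<in> borel_measurable N"
  unfolding qform_def
  using assms by (intro borel_measurable_sum borel_measurable_times measurable_compose[OF _ borel_measurable_cnj]) auto

lemma borel_measurable_tr:
  assumes "\<And>i j. i < n \<Longrightarrow> j < n \<Longrightarrow> (\<lambda>\<omega>. G \<omega> i j) \<in> borel_measurable N"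
  shows "(\<lambda>\<omega>. tr n (G \<omega>)) \<in> borel_measurable N"
  unfolding tr_def using assms by (intro borel_measurable_sum) auto

text \<open>Elimination branches on its pivots, so measurability is taken from the Sherman-Morrison
  recursion, which expresses the entries rationally in the vectors.\<close>

lemma borel_measurable_resolvent:
  assumes "finite S" "beta > 0" "i < n" "j < n"
    and "\<And>k i. k \<in> S \<Longrightarrow> i < n \<Longrightarrow> (\<lambda>\<omega>. b \<omega> k i) \<in> borel_measurable N"
  shows "(\<lambda>\<omega>. resolvent n beta S (b \<omega>) i j) \<in> borel_measurable N"
  using assms(1,3-)
proof (induction S arbitrary: i j)
  case empty
  then show ?case using \<open>beta > 0\<close> by (simp add: resolvent_empty)
next
  case (insert k S)
  have G: "(\<lambda>\<omega>. resolvent n beta S (b \<omega>) i j) \<in> borel_measurable N" if "i < n" "j < n" for i j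
    using insert that by auto
  have b: "(\<lambda>\<omega>. b \<omega> k i) \<in> borel_measurable N" if "i < n" for i
    using insert.prems that by auto
  have "(\<lambda>\<omega>. rank_one_update n (resolvent n beta S (b \<omega>)) (b \<omega> k) i j) \<in> borel_measurable N"
    unfolding rank_one_update_def
    using insert.prems G b
    by (intro borel_measurable_diff borel_measurable_divide borel_measurable_times borel_measurable_sum
        borel_measurable_add borel_measurable_qform measurable_compose[OF _ borel_measurable_cnj]) auto
  then show ?case
    using insert \<open>beta > 0\<close> by (simp add: resolvent_insert)
qed

lemma resolvent_cong:
  assumes "\<And>k i. k \<in> S \<Longrightarrow> i < n \<Longrightarrow> b k i = b' k i"
  shows "resolvent n beta S b = resolvent n beta S b'"
proof -
  have "mat n n (\<lambda>(i, j). gram beta S b i j) = mat n n (\<lambda>(i, j). gram beta S b' i j)"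
    using assms by (auto intro!: eq_matI sum.cong simp: gram_def)
  then show ?thesis by (simp add: fun_eq_iff resolvent_def)
qed

lemma qform_cong:
  assumes "\<And>i. i < n \<Longrightarrow> u i = u' i"
  shows "qform n G u = qform n G u'"
  using assms by (auto simp: qform_def intro!: sum.cong)

text \<open>With the vectors in \<open>S\<close> frozen, the resolvent is a fixed Hermitian matrix
  whose row bound 1/beta^2 does not depend on them, so the bound for deterministic matrices survives
  the outer integration unchanged.\<close>

lemma (in prob_space) fourth_moment_resolvent_form:
  assumes CN: "indep_CN_vectors M n K v X" and "beta > 0"
    and S: "S \<subseteq> {1..K}" and k: "k \<in> {1..K}" "k \<notin> S" and "v k > 0"
  defines "U \<equiv> \<lambda>\<omega>. Re (qform n (resolvent n beta S (\<lambda>k. X k \<omega>)) (X k \<omega>))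
      - v k * Re (tr n (resolvent n beta S (\<lambda>k. X k \<omega>)))"
  shows "integrable M (\<lambda>\<omega>. U \<omega> ^ 4)" "expectation (\<lambda>\<omega>. U \<omega> ^ 4) \<le> (356 * (v k)\<^sup>2 / beta\<^sup>2 * real n)\<^sup>2"
proof -
  define x where "x = (\<lambda>(k::nat, i::nat, re). \<lambda>\<omega>. if re then Re (X k \<omega> i) else Im (X k \<omega> i))"
  \<comment> \<open>Rebuilds the complex vectors from real coordinates, so that \<open>F\<close>
    lives on a product of two coordinate spaces. The result agrees with \<open>X\<close> only at the
    relevant indices, whence the congruence rules.\<close>
  define z where "z y k i = complex_of_real (y (k, i, True)) + \<i> * complex_of_real (y (k, i, False))"
    for y :: "nat \<times> nat \<times> bool \<Rightarrow> real" and k i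
  define A where "A = S \<times> {..<n} \<times> (UNIV :: bool set)"
  define B where "B = {k} \<times> {..<n} \<times> (UNIV :: bool set)"
  define F where "F = (\<lambda>(y, w). (Re (qform n (resolvent n beta S (z y)) (z w k))
      - v k * Re (tr n (resolvent n beta S (z y)))) ^ 4)"
  define YA where "YA \<omega> = (\<lambda>p\<in>A. x p \<omega>)" for \<omega>
  define YB where "YB \<omega> = (\<lambda>p\<in>B. x p \<omega>)" for \<omega>
  let ?PA = "PiM A (\<lambda>_. borel :: real measure)" and ?PB = "PiM B (\<lambda>_. borel :: real measure)"
  have finS: "finite S" using S finite_subset by blast
  note inv = resolvent_right_inv[OF finS \<open>beta > 0\<close>, of n]
  have "indep_vars (\<lambda>_. borel) x ({1..K} \<times> {..<n} \<times> UNIV)"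
    using CN by (simp add: indep_CN_vectors_def x_def)
  moreover have "A \<inter> B = {}" "A \<subseteq> {1..K} \<times> {..<n} \<times> UNIV" "B \<subseteq> {1..K} \<times> {..<n} \<times> UNIV"
    using S k by (auto simp: A_def B_def)
  ultimately have "indep_var ?PA YA ?PB YB"
    unfolding YA_def YB_def by (rule indep_var_restrict)
  then have rv: "YA \<in> M \<rightarrow>\<^sub>M ?PA" "YB \<in> M \<rightarrow>\<^sub>M ?PB"
    and distr: "distr M ?PA YA \<Otimes>\<^sub>M distr M ?PB YB = distr M (?PA \<Otimes>\<^sub>M ?PB) (\<lambda>\<omega>. (YA \<omega>, YB \<omega>))"
    by (simp_all add: indep_var_distribution_eq)
  have zA: "(\<lambda>yw. z (fst yw) l i) \<in> borel_measurable (?PA \<Otimes>\<^sub>M ?PB)" if "l \<in> S" "i < n" for l i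
    using that unfolding z_def
    by (intro borel_measurable_add borel_measurable_times borel_measurable_const borel_measurable_of_real
        measurable_compose[OF measurable_fst measurable_component_singleton]) (auto simp: A_def)
  have zB: "(\<lambda>yw. z (snd yw) k i) \<in> borel_measurable (?PA \<Otimes>\<^sub>M ?PB)" if "i < n" for i
    using that unfolding z_def
    by (intro borel_measurable_add borel_measurable_times borel_measurable_const borel_measurable_of_real
        measurable_compose[OF measurable_snd measurable_component_singleton]) (auto simp: B_def)
  note R = borel_measurable_resolvent[OF finS \<open>beta > 0\<close> _ _ zA]
  have [measurable]: "(\<lambda>yw. qform n (resolvent n beta S (z (fst yw))) (z (snd yw) k)) \<in> borel_measurable (?PA \<Otimes>\<^sub>M ?PB)"
      "(\<lambda>yw. tr n (resolvent n beta S (z (fst yw)))) \<in> borel_measurable (?PA \<Otimes>\<^sub>M ?PB)"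
    by (intro borel_measurable_qform borel_measurable_tr R zB; simp)+
  have F: "F \<in> borel_measurable (?PA \<Otimes>\<^sub>M ?PB)"
    unfolding F_def case_prod_unfold by measurable
  interpret YB: prob_space "distr M ?PB YB" by (rule prob_space_distr) fact
  have UF: "U \<omega> ^ 4 = F (YA \<omega>, YB \<omega>)" for \<omega>
  proof -
    have "resolvent n beta S (z (YA \<omega>)) = resolvent n beta S (\<lambda>k. X k \<omega>)"
      by (intro resolvent_cong) (auto simp: z_def YA_def A_def x_def complex_eq_iff)
    moreover have "qform n G (z (YB \<omega>) k) = qform n G (X k \<omega>)" for G
      by (intro qform_cong) (auto simp: z_def YB_def B_def x_def complex_eq_iff)
    ultimately show ?thesis by (simp add: F_def U_def)
  qed
  have meas: "(\<lambda>\<omega>. U \<omega> ^ 4) \<in> borel_measurable M"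
    unfolding UF using rv F by measurable
  let ?C = "(356 * (v k)\<^sup>2 / beta\<^sup>2 * real n)\<^sup>2"
  have "(\<integral>\<^sup>+\<omega>. ennreal (U \<omega> ^ 4) \<partial>M) = (\<integral>\<^sup>+yw. ennreal (F yw) \<partial>distr M (?PA \<Otimes>\<^sub>M ?PB) (\<lambda>\<omega>. (YA \<omega>, YB \<omega>)))"
    unfolding UF using rv F by (subst nn_integral_distr) auto
  \<comment> \<open>Independence makes the joint law a product, and Tonelli integrates over the
    vector \<open>k\<close> first.\<close>
  also have "\<dots> = (\<integral>\<^sup>+y. \<integral>\<^sup>+w. ennreal (F (y, w)) \<partial>distr M ?PB YB \<partial>distr M ?PA YA)"
    unfolding distr[symmetric] using F by (subst YB.nn_integral_fst) (auto cong: measurable_cong_sets)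
  also have "\<dots> \<le> (\<integral>\<^sup>+y. ennreal ?C \<partial>distr M ?PA YA)"
  proof (rule nn_integral_mono)
    fix y assume "y \<in> space (distr M ?PA YA)"
    then have y: "y \<in> space ?PA" by simp
    define G where "G = resolvent n beta S (z y)"
    have "(\<integral>\<^sup>+w. ennreal (F (y, w)) \<partial>distr M ?PB YB) = (\<integral>\<^sup>+\<omega>. ennreal (F (y, YB \<omega>)) \<partial>M)"
      using rv F y by (subst nn_integral_distr) auto
    also have "\<dots> = (\<integral>\<^sup>+\<omega>. ennreal ((Re (qform n G (X k \<omega>)) - v k * Re (tr n G)) ^ 4) \<partial>M)"
    proof -
      have "qform n G (z (YB \<omega>) k) = qform n G (X k \<omega>)" for \<omega>
        by (intro qform_cong) (auto simp: z_def YB_def B_def x_def complex_eq_iff)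
      then show ?thesis by (simp add: F_def G_def)
    qed
    also have "\<dots> \<le> ennreal ((356 * (v k)\<^sup>2 * (1 / beta\<^sup>2) * real n)\<^sup>2)"
      unfolding G_def
      using right_inv_hermitian[OF cnj_gram inv] gram_inv_row_bound[OF inv \<open>beta > 0\<close>] \<open>v k > 0\<close>
      by (intro fourth_moment_complex_gaussian_form[OF CN k(1)]) auto
    finally show "(\<integral>\<^sup>+w. ennreal (F (y, w)) \<partial>distr M ?PB YB) \<le> ennreal ?C" by simp
  qed
  also have "\<dots> = ennreal ?C"
    using prob_space.emeasure_space_1[OF prob_space_distr[OF rv(1)]] by simp
  finally have le: "(\<integral>\<^sup>+\<omega>. ennreal (U \<omega> ^ 4) \<partial>M) \<le> ennreal ?C" .
  show int: "integrable M (\<lambda>\<omega>. U \<omega> ^ 4)"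
    using le meas by (intro integrableI_bounded) (auto simp: le_less_trans)
  have "ennreal (expectation (\<lambda>\<omega>. U \<omega> ^ 4)) = (\<integral>\<^sup>+\<omega>. ennreal (U \<omega> ^ 4) \<partial>M)"
    by (rule nn_integral_eq_integral[OF int, symmetric]) auto
  with le show "expectation (\<lambda>\<omega>. U \<omega> ^ 4) \<le> ?C"
    by (metis ennreal_le_iff zero_le_power2)
qed

section \<open>Concentration of the SINR\<close>

text \<open>Markov's inequality in pointwise form. If q < c then q is more than c away from t, so
  the last term is at least 1 and dominates; otherwise 1 / (1 + q) is already at most 1/c.\<close>

lemma inverse_square_le_deviation:
  fixes q t c :: real
  assumes "q \<ge> 0" "c > 0" "2 * c \<le> t"
  shows "(1 / (1 + q))\<^sup>2 \<le> 1 / c\<^sup>2 + (q - t) ^ 4 / c ^ 4"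
proof (cases "c \<le> q")
  case True
  have "1 / (1 + q) \<le> 1 / c" using assms True by (intro divide_left_mono) auto
  then have "(1 / (1 + q))\<^sup>2 \<le> (1 / c)\<^sup>2" using assms by (intro power_mono) auto
  also have "\<dots> = 1 / c\<^sup>2" by (simp add: power_divide)
  finally have "(1 / (1 + q))\<^sup>2 \<le> 1 / c\<^sup>2" .
  moreover have "(q - t) ^ 4 / c ^ 4 \<ge> 0" using assms by simp
  ultimately show ?thesis by linarith
next
  case False
  have "(1 / (1 + q))\<^sup>2 \<le> 1\<^sup>2" using assms by (intro power_mono) auto
  moreover have "c ^ 4 \<le> (t - q) ^ 4" using assms False by (intro power_mono) auto
  then have "1 \<le> (t - q) ^ 4 / c ^ 4" using assms by simp
  then have "1 \<le> (q - t) ^ 4 / c ^ 4" by (simp add: power4_eq_xxxx algebra_simps)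
  ultimately show ?thesis using assms by (smt (verit) divide_nonneg_nonneg one_power2 zero_le_power2)
qed

lemma indep_CN_vectors_measurable:
  assumes "prob_space M" "indep_CN_vectors M n K v X" "k \<in> {1..K}" "i < n"
  shows "(\<lambda>\<omega>. X k \<omega> i) \<in> borel_measurable M"
proof -
  have "distributed M lborel (\<lambda>\<omega>. Re (X k \<omega> i)) (\<lambda>x. ennreal (normal_density 0 (sqrt (v k / 2)) x))"
    "distributed M lborel (\<lambda>\<omega>. Im (X k \<omega> i)) (\<lambda>x. ennreal (normal_density 0 (sqrt (v k / 2)) x))"
    using assms by (auto simp: indep_CN_vectors_def)
  then show ?thesis
    unfolding borel_measurable_complex_iff by (auto dest!: distributed_measurable)
qed

text \<open>By the trace identity \<open>Z\<close> is the deviation of one quadratic form from its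
  trace, over n, plus a multiple of the mean t of the terms 1 / (1 + q_k). The former has fourth
  moment of order n^2 / n^4; the latter is small because each q_k is near a quantity of order n. The
  centering uses K - 1 since the tagged user does not enter the matrix.\<close>

lemma (in prob_space) sinr_fourth_moment:
  assumes CN: "indep_CN_vectors M n K v X" and K: "1 \<le> K" "real K \<le> (1 - \<delta>) * real n"
    and lo: "0 < lo" and \<delta>: "0 < \<delta>" and n: "1 \<le> n"
    and v: "\<And>k. k \<in> {1..K} \<Longrightarrow> lo \<le> v k \<and> v k \<le> hi" and beta: "lo \<le> beta" "beta \<le> hi"
  defines "\<gamma> \<equiv> \<lambda>\<omega>. sinr n K beta (X 1 \<omega>) (\<lambda>k. X k \<omega>)"
    and "C \<equiv> (356 * hi\<^sup>2 / lo\<^sup>2)\<^sup>2" and "c \<equiv> lo * \<delta> / (2 * hi)"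
  defines "Z \<equiv> \<lambda>\<omega>. (Re (\<gamma> \<omega>) - v 1 * (real n - real (K - 1)) / beta) / real n"
  shows "\<gamma> \<in> borel_measurable M" "\<And>\<omega>. \<gamma> \<omega> = complex_of_real (Re (\<gamma> \<omega>))"
    "integrable M (\<lambda>\<omega>. Z \<omega> ^ 4)"
    "expectation (\<lambda>\<omega>. Z \<omega> ^ 4) \<le> (8 * C + 8 * (hi / lo) ^ 4 * (1 / c\<^sup>2 + C / c ^ 4)) / (real n)\<^sup>2"
proof -
  define S where "S = {2..K}"
  define G where "G T \<omega> = resolvent n beta T (\<lambda>k. X k \<omega>)" for T \<omega>
  define U where "U T k \<omega> = Re (qform n (G T \<omega>) (X k \<omega>)) - v k * Re (tr n (G T \<omega>))" for T k \<omega>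
  define q where "q k \<omega> = Re (qform n (G (S - {k}) \<omega>) (X k \<omega>))" for k \<omega>
  have b0: "beta > 0" and hi: "hi > 0" using beta lo by auto
  have c: "c > 0" using lo \<delta> hi by (simp add: c_def)
  have n0: "real n > 0" using n by simp
  have cn: "c * real n > 0" using c n0 by simp
  have C0: "C \<ge> 0" by (simp add: C_def)
  have "(1 - \<delta>) * real n \<le> 1 * real n"
    using \<delta> by (intro mult_right_mono) auto
  then have Kn: "K \<le> n" using K(2) by simp
  have S: "finite S" "S \<subseteq> {1..K}" "1 \<notin> S" "card S = K - 1" by (auto simp: S_def)
  have inv: "right_inv n (gram beta T (\<lambda>k. X k \<omega>)) (G T \<omega>)" if "T \<subseteq> S" for T \<omega>
    unfolding G_def using that S b0 finite_subset by (intro resolvent_right_inv) auto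
  have \<gamma>: "\<gamma> \<omega> = qform n (G S \<omega>) (X 1 \<omega>)" for \<omega>
    by (simp add: \<gamma>_def sinr_eq_qform G_def S_def)
  note X = indep_CN_vectors_measurable[OF prob_space_axioms CN]
  show meas: "\<gamma> \<in> borel_measurable M"
    unfolding \<gamma>[abs_def] G_def using S K X b0
    by (intro borel_measurable_qform borel_measurable_resolvent) auto
  show "\<gamma> \<omega> = complex_of_real (Re (\<gamma> \<omega>))" for \<omega>
    using qform_gram_inv_nonneg(1)[OF inv b0] by (simp add: \<gamma>)
  have U: "integrable M (\<lambda>\<omega>. U T k \<omega> ^ 4)" "expectation (\<lambda>\<omega>. U T k \<omega> ^ 4) \<le> C * (real n)\<^sup>2"
    if T: "T \<subseteq> S" and k: "k \<in> {1..K}" "k \<notin> T" for T k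
  proof -
    have vk: "0 < v k" "v k \<le> hi" using v[OF k(1)] lo by auto
    have T': "T \<subseteq> {1..K}" using T S by auto
    note m = fourth_moment_resolvent_form[OF CN b0 T' k vk(1)]
    show "integrable M (\<lambda>\<omega>. U T k \<omega> ^ 4)"
      using m(1) by (simp add: U_def G_def)
    have "expectation (\<lambda>\<omega>. U T k \<omega> ^ 4) \<le> (356 * (v k)\<^sup>2 / beta\<^sup>2 * real n)\<^sup>2"
      using m(2) by (simp add: U_def G_def)
    also have "\<dots> \<le> (356 * hi\<^sup>2 / lo\<^sup>2 * real n)\<^sup>2"
      using vk beta lo by (intro power_mono mult_right_mono frac_le mult_left_mono) auto
    finally show "expectation (\<lambda>\<omega>. U T k \<omega> ^ 4) \<le> C * (real n)\<^sup>2"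
      by (simp add: C_def flip: power_mult_distrib)
  qed
  have q0: "q k \<omega> \<ge> 0" for k \<omega>
    unfolding q_def by (intro qform_gram_inv_nonneg(2)[OF inv b0]) auto
  \<comment> \<open>This fixes \<open>c\<close>: the trace is at least delta n / hi and
    \<open>v k\<close> is at least lo, so their product is at least 2 c n, the factor 2 leaving room
    for a deviation of c n.\<close>
  have trlow: "2 * (c * real n) \<le> v k * Re (tr n (G (S - {k}) \<omega>))" if "k \<in> S" for k \<omega>
  proof -
    have vk: "lo \<le> v k" using v that S by auto
    have "card (S - {k}) \<le> K" using S card_mono[of S "S - {k}"] by auto
    then have "\<delta> * real n \<le> real n - real (card (S - {k}))"
      using K by (simp add: algebra_simps)
    then have "\<delta> * real n / hi \<le> (real n - real (card (S - {k}))) / beta"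
      using beta b0 hi \<delta> n0 Kn \<open>card (S - {k}) \<le> K\<close> by (intro frac_le) auto
    also have "\<dots> \<le> Re (tr n (G (S - {k}) \<omega>))"
      unfolding G_def using S b0 by (intro tr_resolvent_lower) auto
    finally have "lo * (\<delta> * real n / hi) \<le> v k * Re (tr n (G (S - {k}) \<omega>))"
      using vk lo \<delta> hi n0 by (intro mult_mono) auto
    then show ?thesis by (simp add: c_def)
  qed
  \<comment> \<open>A pointwise majorant built from the \<open>U\<close> terms only, so that its
    expectation can be evaluated term by term.\<close>
  define V where "V \<omega> = 8 / real n ^ 4 * U S 1 \<omega> ^ 4 +
      8 * (hi / lo) ^ 4 * (1 / real n * (\<Sum>k\<in>S. 1 / (c * real n)\<^sup>2 + U (S - {k}) k \<omega> ^ 4 / (c * real n) ^ 4))" for \<omega>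
  have ZV: "Z \<omega> ^ 4 \<le> V \<omega>" for \<omega>
  proof -
    define t where "t = (\<Sum>k\<in>S. 1 / (1 + q k \<omega>)) / real n"
    have "beta * Re (tr n (G S \<omega>)) = real n - real (K - 1) + (\<Sum>k\<in>S. 1 / (1 + q k \<omega>))"
      using tr_resolvent_identity[OF S(1) b0, of n "\<lambda>k. X k \<omega>"] by (simp add: G_def q_def S)
    then have tr: "Re (tr n (G S \<omega>)) = (real n - real (K - 1) + real n * t) / beta"
      using b0 n0 by (simp add: t_def field_simps)
    have Z: "Z \<omega> = U S 1 \<omega> / real n + v 1 / beta * t"
      using b0 n0 by (simp add: Z_def \<gamma> U_def tr field_simps)
    have cardn: "real (card S) \<le> real n"
      using Kn S by simp
    have t0: "t \<ge> 0" unfolding t_def using q0 by (intro divide_nonneg_nonneg sum_nonneg) (auto simp: add_nonneg_nonneg)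
    have "(\<Sum>k\<in>S. 1 / (1 + q k \<omega>)) \<le> (\<Sum>k\<in>S. 1)"
      using q0 by (intro sum_mono) (simp add: add_pos_nonneg)
    then have t1: "t \<le> 1" using cardn n0 by (simp add: t_def)
    \<comment> \<open>Since 0 <= t <= 1, squares suffice for t; Cauchy-Schwarz then brings in the
      terms 1 / (1 + q_k)^2 that the deviation lemma controls.\<close>
    have "t ^ 4 \<le> t\<^sup>2" using t0 t1 by (intro power_decreasing) auto
    also have "\<dots> = (\<Sum>k\<in>S. 1 / (1 + q k \<omega>))\<^sup>2 / (real n)\<^sup>2" by (simp add: t_def power_divide)
    also have "\<dots> \<le> ((\<Sum>k\<in>S. (1 / (1 + q k \<omega>))\<^sup>2) * real (card S)) / (real n)\<^sup>2"
      by (intro divide_right_mono sum_squared_le_sum_of_squares) auto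
    also have "\<dots> \<le> ((\<Sum>k\<in>S. (1 / (1 + q k \<omega>))\<^sup>2) * real n) / (real n)\<^sup>2"
      using cardn by (intro divide_right_mono mult_left_mono sum_nonneg) auto
    also have "\<dots> = 1 / real n * (\<Sum>k\<in>S. (1 / (1 + q k \<omega>))\<^sup>2)"
      using n0 by (simp add: power2_eq_square)
    also have "\<dots> \<le> 1 / real n * (\<Sum>k\<in>S. 1 / (c * real n)\<^sup>2 + U (S - {k}) k \<omega> ^ 4 / (c * real n) ^ 4)"
      unfolding U_def q_def[symmetric]
      by (intro mult_left_mono sum_mono inverse_square_le_deviation q0 cn trlow) auto
    finally have t4: "t ^ 4 \<le> 1 / real n * (\<Sum>k\<in>S. 1 / (c * real n)\<^sup>2 + U (S - {k}) k \<omega> ^ 4 / (c * real n) ^ 4)" .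
    have v1: "0 \<le> v 1 / beta" "v 1 / beta \<le> hi / lo"
      using v[of 1] K beta lo b0 by (auto intro!: frac_le)
    have "Z \<omega> ^ 4 \<le> 8 * (U S 1 \<omega> / real n) ^ 4 + 8 * (v 1 / beta * t) ^ 4"
      unfolding Z by (rule power4_sum_le)
    also have "(v 1 / beta * t) ^ 4 \<le> (hi / lo) ^ 4 * t ^ 4"
      unfolding power_mult_distrib using v1 t0 by (intro mult_right_mono power_mono) auto
    also have "\<dots> \<le> (hi / lo) ^ 4 * (1 / real n * (\<Sum>k\<in>S. 1 / (c * real n)\<^sup>2 + U (S - {k}) k \<omega> ^ 4 / (c * real n) ^ 4))"
      by (intro mult_left_mono t4) auto
    finally show ?thesis by (simp add: V_def power_divide)
  qed
  have iU1: "integrable M (\<lambda>\<omega>. U S 1 \<omega> ^ 4)" using U(1)[of S 1] S K by auto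
  have iUk: "integrable M (\<lambda>\<omega>. U (S - {k}) k \<omega> ^ 4)" if "k \<in> S" for k
    using U(1)[of "S - {k}" k] S that by auto
  have iV: "integrable M V"
    unfolding V_def using iU1 iUk by (intro Bochner_Integration.integrable_add integrable_mult_right Bochner_Integration.integrable_sum integrable_divide) auto
  have mZ: "Z \<in> borel_measurable M"
    unfolding Z_def using meas by measurable
  show iZ: "integrable M (\<lambda>\<omega>. Z \<omega> ^ 4)"
  proof (rule Bochner_Integration.integrable_bound[OF iV])
    show "(\<lambda>\<omega>. Z \<omega> ^ 4) \<in> borel_measurable M" using mZ by measurable
    show "AE \<omega> in M. norm (Z \<omega> ^ 4) \<le> norm (V \<omega>)"
      using ZV by (auto intro: order_trans[OF _ abs_ge_self])
  qed
  have "expectation (\<lambda>\<omega>. Z \<omega> ^ 4) \<le> expectation V"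
    using iZ iV ZV by (intro integral_mono) auto
  also have "\<dots> = 8 / real n ^ 4 * expectation (\<lambda>\<omega>. U S 1 \<omega> ^ 4) +
      8 * (hi / lo) ^ 4 * (1 / real n * (\<Sum>k\<in>S. 1 / (c * real n)\<^sup>2 + expectation (\<lambda>\<omega>. U (S - {k}) k \<omega> ^ 4) / (c * real n) ^ 4))"
  proof -
    have "expectation (\<lambda>\<omega>. \<Sum>k\<in>S. 1 / (c * real n)\<^sup>2 + U (S - {k}) k \<omega> ^ 4 / (c * real n) ^ 4) =
       (\<Sum>k\<in>S. expectation (\<lambda>\<omega>. 1 / (c * real n)\<^sup>2 + U (S - {k}) k \<omega> ^ 4 / (c * real n) ^ 4))"
      using iUk by (intro Bochner_Integration.integral_sum Bochner_Integration.integrable_add integrable_divide) auto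
    also have "\<dots> = (\<Sum>k\<in>S. 1 / (c * real n)\<^sup>2 + expectation (\<lambda>\<omega>. U (S - {k}) k \<omega> ^ 4) / (c * real n) ^ 4)"
    proof (intro sum.cong refl)
      fix k assume "k \<in> S"
      then have "integrable M (\<lambda>\<omega>. U (S - {k}) k \<omega> ^ 4 / (c * real n) ^ 4)" using iUk by simp
      then show "expectation (\<lambda>\<omega>. 1 / (c * real n)\<^sup>2 + U (S - {k}) k \<omega> ^ 4 / (c * real n) ^ 4) =
          1 / (c * real n)\<^sup>2 + expectation (\<lambda>\<omega>. U (S - {k}) k \<omega> ^ 4) / (c * real n) ^ 4"
        by (subst Bochner_Integration.integral_add) (auto simp: prob_space)
    qed
    finally have e: "expectation (\<lambda>\<omega>. \<Sum>k\<in>S. 1 / (c * real n)\<^sup>2 + U (S - {k}) k \<omega> ^ 4 / (c * real n) ^ 4) = \<dots>" .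
    have i: "integrable M (\<lambda>\<omega>. \<Sum>k\<in>S. 1 / (c * real n)\<^sup>2 + U (S - {k}) k \<omega> ^ 4 / (c * real n) ^ 4)"
      using iUk by (intro Bochner_Integration.integrable_sum Bochner_Integration.integrable_add integrable_divide) auto
    show ?thesis
      unfolding V_def using iU1 i
      by (subst Bochner_Integration.integral_add) (auto simp only: integral_mult_right_zero e intro!: integrable_mult_right)
  qed
  also have "\<dots> \<le> 8 / real n ^ 4 * (C * (real n)\<^sup>2) +
      8 * (hi / lo) ^ 4 * (1 / real n * (real n * (1 / (c * real n)\<^sup>2 + (C * (real n)\<^sup>2) / (c * real n) ^ 4)))"
  proof (intro add_mono mult_left_mono)
    show "expectation (\<lambda>\<omega>. U S 1 \<omega> ^ 4) \<le> C * (real n)\<^sup>2" using U(2)[of S 1] S K by auto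
    have "(\<Sum>k\<in>S. 1 / (c * real n)\<^sup>2 + expectation (\<lambda>\<omega>. U (S - {k}) k \<omega> ^ 4) / (c * real n) ^ 4)
        \<le> (\<Sum>k\<in>S. 1 / (c * real n)\<^sup>2 + (C * (real n)\<^sup>2) / (c * real n) ^ 4)"
      using S by (intro sum_mono add_left_mono divide_right_mono U(2)) auto
    also have "\<dots> = real (card S) * (1 / (c * real n)\<^sup>2 + (C * (real n)\<^sup>2) / (c * real n) ^ 4)" by simp
    also have "\<dots> \<le> real n * (1 / (c * real n)\<^sup>2 + (C * (real n)\<^sup>2) / (c * real n) ^ 4)"
    proof (rule mult_right_mono)
      show "real (card S) \<le> real n" using S Kn by simp
    qed (use C0 c n0 in auto)
    finally show "(\<Sum>k\<in>S. 1 / (c * real n)\<^sup>2 + expectation (\<lambda>\<omega>. U (S - {k}) k \<omega> ^ 4) / (c * real n) ^ 4)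
      \<le> real n * (1 / (c * real n)\<^sup>2 + (C * (real n)\<^sup>2) / (c * real n) ^ 4)" .
  qed (use lo hi n0 in auto)
  also have "\<dots> = (8 * C + 8 * (hi / lo) ^ 4 * (1 / c\<^sup>2 + C / c ^ 4)) / (real n)\<^sup>2"
    using n0 c by (simp add: power2_eq_square power4_eq_xxxx add_divide_distrib distrib_left) (simp add: mult_ac)
  finally show "expectation (\<lambda>\<omega>. Z \<omega> ^ 4) \<le> (8 * C + 8 * (hi / lo) ^ 4 * (1 / c\<^sup>2 + C / c ^ 4)) / (real n)\<^sup>2" .
qed

text \<open>The series of the fourth powers has finite expectation, hence converges almost
  everywhere, and its terms tend to 0. This uses the law of each \<open>Y n\<close> alone.\<close>

lemma (in prob_space) fourth_moment_summable_convergence: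
  fixes Y :: "nat \<Rightarrow> 'a \<Rightarrow> real"
  assumes meas: "\<And>n. N \<le> n \<Longrightarrow> Y n \<in> borel_measurable M"
    and int: "\<And>n. N \<le> n \<Longrightarrow> integrable M (\<lambda>\<omega>. Y n \<omega> ^ 4)"
    and bound: "\<And>n. N \<le> n \<Longrightarrow> expectation (\<lambda>\<omega>. Y n \<omega> ^ 4) \<le> C / (real n)\<^sup>2"
    and N: "1 \<le> N"
  shows "AE \<omega> in M. (\<lambda>n. Y n \<omega>) \<longlonglongrightarrow> 0"
    "(\<lambda>n. expectation (Y n)) \<longlonglongrightarrow> 0"
    "\<And>n. N \<le> n \<Longrightarrow> integrable M (Y n)"
proof -
  define Z where "Z n \<omega> = Y (n + N) \<omega> ^ 4" for n \<omega>
  have mZ [measurable]: "Z n \<in> borel_measurable M" for n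
    unfolding Z_def using meas[of "n + N"] by measurable
  have Z0: "Z n \<omega> \<ge> 0" for n \<omega> by (simp add: Z_def)
  have C0: "C \<ge> 0"
  proof -
    have "0 \<le> expectation (\<lambda>\<omega>. Y N \<omega> ^ 4)" by (intro integral_nonneg_AE) auto
    also have "\<dots> \<le> C / (real N)\<^sup>2" by (intro bound) auto
    finally show ?thesis using N by (auto simp: zero_le_divide_iff)
  qed
  have "summable (\<lambda>n. C * inverse ((real (n + N))\<^sup>2))"
    by (intro summable_mult summable_ignore_initial_segment inverse_power_summable) auto
  then have summ: "summable (\<lambda>n. C / (real (n + N))\<^sup>2)" by (simp add: divide_inverse)
  have "(\<integral>\<^sup>+\<omega>. (\<Sum>n. ennreal (Z n \<omega>)) \<partial>M) = (\<Sum>n. \<integral>\<^sup>+\<omega>. ennreal (Z n \<omega>) \<partial>M)"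
    by (rule nn_integral_suminf) measurable
  also have "\<dots> \<le> (\<Sum>n. ennreal (C / (real (n + N))\<^sup>2))"
  proof (rule suminf_le)
    fix n
    have "(\<integral>\<^sup>+\<omega>. ennreal (Z n \<omega>) \<partial>M) = ennreal (expectation (Z n))"
      unfolding Z_def by (intro nn_integral_eq_integral int) auto
    also have "\<dots> \<le> ennreal (C / (real (n + N))\<^sup>2)"
      unfolding Z_def by (intro ennreal_leI bound) simp
    finally show "(\<integral>\<^sup>+\<omega>. ennreal (Z n \<omega>) \<partial>M) \<le> ennreal (C / (real (n + N))\<^sup>2)" .
  qed auto
  also have "\<dots> = ennreal (\<Sum>n. C / (real (n + N))\<^sup>2)"
    using C0 by (intro suminf_ennreal2 summ) auto
  also have "\<dots> < \<infinity>" by simp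
  finally have "AE \<omega> in M. (\<Sum>n. ennreal (Z n \<omega>)) \<noteq> \<infinity>"
    by (intro nn_integral_PInf_AE) auto
  then show "AE \<omega> in M. (\<lambda>n. Y n \<omega>) \<longlonglongrightarrow> 0"
  proof eventually_elim
    case (elim \<omega>)
    then have "summable (\<lambda>n. Z n \<omega>)"
      using Z0 by (intro summable_suminf_not_top) auto
    then have "(\<lambda>n. Z n \<omega>) \<longlonglongrightarrow> 0" by (rule summable_LIMSEQ_zero)
    then have "(\<lambda>n. root 4 (Z n \<omega>)) \<longlonglongrightarrow> root 4 0" by (intro tendsto_real_root)
    moreover have "root 4 (Z n \<omega>) = \<bar>Y (n + N) \<omega>\<bar>" for n
      using real_root_power_cancel[of 4 "\<bar>Y (n + N) \<omega>\<bar>"] by (simp add: Z_def)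
    ultimately have "(\<lambda>n. \<bar>Y (n + N) \<omega>\<bar>) \<longlonglongrightarrow> 0" by simp
    then have "(\<lambda>n. Y (n + N) \<omega>) \<longlonglongrightarrow> 0" by (simp add: tendsto_rabs_zero_iff)
    then show ?case by (rule LIMSEQ_offset)
  qed
  \<comment> \<open>A bound on the first moment with a free parameter: below 1/s the second term
    suffices, above it s |y| >= 1 lets three further factors be inserted.\<close>
  have pw: "\<bar>y\<bar> \<le> s ^ 3 * y ^ 4 + 1 / s" if s: "s > 0" for s y :: real
  proof (cases "\<bar>y\<bar> \<le> 1 / s")
    case True
    moreover have "0 \<le> s ^ 3 * y ^ 4" using s by simp
    ultimately show ?thesis by linarith
  next
    case False
    then have "1 \<le> s * \<bar>y\<bar>" using s by (simp add: field_simps)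
    then have "\<bar>y\<bar> * 1 \<le> \<bar>y\<bar> * (s * \<bar>y\<bar>) ^ 3" by (intro mult_left_mono one_le_power) auto
    also have "\<dots> = s ^ 3 * y ^ 4"
      by (subst power_even_abs[symmetric, of 4]) (auto simp: power_mult_distrib power4_eq_xxxx power3_eq_cube)
    finally have "\<bar>y\<bar> \<le> s ^ 3 * y ^ 4" by simp
    moreover have "0 < 1 / s" using s by simp
    ultimately show ?thesis by linarith
  qed
  show iY: "integrable M (Y n)" if "N \<le> n" for n
  proof (rule Bochner_Integration.integrable_bound)
    show "integrable M (\<lambda>\<omega>. 1 ^ 3 * Y n \<omega> ^ 4 + 1 / 1)" using int[OF that] by simp
    show "AE \<omega> in M. norm (Y n \<omega>) \<le> norm (1 ^ 3 * Y n \<omega> ^ 4 + 1 / 1)"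
      using pw[of 1] by (auto intro!: order_trans[OF _ abs_ge_self])
  qed (use meas that in auto)
  have le: "\<bar>expectation (Y n)\<bar> \<le> (C + 1) / sqrt (real n)" if n: "N \<le> n" for n
  proof -
    \<comment> \<open>With s = sqrt n both s^3 / n^2 and 1 / s are of order 1 / sqrt n.\<close>
    define s where "s = sqrt (real n)"
    have s: "s > 0" "s\<^sup>2 = real n" using n N by (auto simp: s_def)
    have "\<bar>expectation (Y n)\<bar> \<le> expectation (\<lambda>\<omega>. \<bar>Y n \<omega>\<bar>)" by (rule integral_abs_bound)
    also have "\<dots> \<le> expectation (\<lambda>\<omega>. s ^ 3 * Y n \<omega> ^ 4 + 1 / s)"
      using iY[OF n] int[OF n] pw s by (intro integral_mono) auto
    also have "\<dots> = s ^ 3 * expectation (\<lambda>\<omega>. Y n \<omega> ^ 4) + 1 / s"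
      using int[OF n] by (simp add: prob_space)
    also have "\<dots> \<le> s ^ 3 * (C / (real n)\<^sup>2) + 1 / s"
      using s by (intro add_right_mono mult_left_mono bound n) auto
    also have "\<dots> = (C + 1) / s"
      using s(1) unfolding s(2)[symmetric] by (simp add: field_simps power2_eq_square power3_eq_cube)
    finally show ?thesis by (simp add: s_def)
  qed
  have "(\<lambda>n. (C + 1) / sqrt (real n)) \<longlonglongrightarrow> 0"
    by (rule real_tendsto_divide_at_top[OF tendsto_const filterlim_compose[OF sqrt_at_top filterlim_real_sequentially]])
  then show "(\<lambda>n. expectation (Y n)) \<longlonglongrightarrow> 0"
    by (rule Lim_null_comparison[rotated]) (auto intro!: eventually_sequentiallyI[of N] le)
qed

section \<open>The deterministic equivalent\<close>

text \<open>Multiplying by g turns the equation into the trace identity for \<open>{2..K}\<close>,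
  with g in the place of phi times the trace and g phi_k / phi in the place of q_k. The sum now
  decreases in g, which serves both uniqueness and asymptotics.\<close>

lemma gbar_eq_iff:
  fixes p :: "nat \<Rightarrow> real"
  assumes ph: "\<And>k. k \<in> {1..K} \<Longrightarrow> ph k = complex_of_real (p k)" and p: "\<And>k. k \<in> {1..K} \<Longrightarrow> p k > 0"
    and "1 \<le> K" "g > 0"
  shows "gbar_eq Nr K ph beta g \<longleftrightarrow>
    beta * g = p 1 * (real Nr - real (K - 1)) + (\<Sum>k\<in>{2..K}. p 1 / (1 + g * p k / p 1))"
proof -
  have p1: "ph 1 = complex_of_real (p 1)" "p 1 > 0" using ph p \<open>1 \<le> K\<close> by auto
  have "(\<Sum>k\<in>{2..K}. ph k / (1 + complex_of_real g * ph k / ph 1))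
      = complex_of_real (\<Sum>k\<in>{2..K}. p k / (1 + g * p k / p 1))"
    unfolding of_real_sum by (intro sum.cong refl) (use ph p1 in \<open>simp\<close>)
  then have "gbar_eq Nr K ph beta g \<longleftrightarrow> complex_of_real beta =
      complex_of_real (real Nr * p 1 / g - (\<Sum>k\<in>{2..K}. p k / (1 + g * p k / p 1)))"
    unfolding gbar_eq_def using p1 by simp
  also have "\<dots> \<longleftrightarrow> beta = real Nr * p 1 / g - (\<Sum>k\<in>{2..K}. p k / (1 + g * p k / p 1))"
    by (rule of_real_eq_iff)
  also have "\<dots> \<longleftrightarrow> beta * g = real Nr * p 1 - (\<Sum>k\<in>{2..K}. g * (p k / (1 + g * p k / p 1)))"
    using \<open>g > 0\<close> by (auto simp: field_simps sum_distrib_left)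
  also have "(\<Sum>k\<in>{2..K}. g * (p k / (1 + g * p k / p 1))) = (\<Sum>k\<in>{2..K}. p 1 - p 1 / (1 + g * p k / p 1))"
  proof (intro sum.cong refl)
    fix k assume "k \<in> {2..K}"
    then have "p k > 0" using p by auto
    then have "1 + g * p k / p 1 > 0" using p1 \<open>g > 0\<close> by (intro add_pos_pos) auto
    then show "g * (p k / (1 + g * p k / p 1)) = p 1 - p 1 / (1 + g * p k / p 1)"
      using p1 by (simp add: divide_simps) (simp add: algebra_simps)
  qed
  also have "\<dots> = p 1 * real (K - 1) - (\<Sum>k\<in>{2..K}. p 1 / (1 + g * p k / p 1))"
    by (simp add: sum_subtractf)
  finally show ?thesis by (simp add: algebra_simps)
qed

lemma gbar_ex1:
  fixes p :: "nat \<Rightarrow> real"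
  assumes ph: "\<And>k. k \<in> {1..K} \<Longrightarrow> ph k = complex_of_real (p k)" and p: "\<And>k. k \<in> {1..K} \<Longrightarrow> p k > 0"
    and "1 \<le> K" "K \<le> Nr" "beta > 0"
  shows "\<exists>!g. g > 0 \<and> gbar_eq Nr K ph beta g"
proof -
  define H where "H g = beta * g - (\<Sum>k\<in>{2..K}. p 1 / (1 + g * p k / p 1))" for g
  define R where "R = p 1 * (real Nr - real (K - 1))"
  have p1: "p 1 > 0" using p \<open>1 \<le> K\<close> by auto
  have pk: "p k > 0" if "k \<in> {2..K}" for k using p that by auto
  have eq: "gbar_eq Nr K ph beta g \<longleftrightarrow> H g = R" if "g > 0" for g
    using gbar_eq_iff[OF ph p \<open>1 \<le> K\<close> that, where Nr = Nr and beta = beta] by (auto simp: H_def R_def)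
  have pos: "1 + g * p k / p 1 > 0" if "g \<ge> 0" "k \<in> {2..K}" for g k
    using pk[OF that(2)] p1 that(1) by (intro add_pos_nonneg) auto
  have mono: "H g < H g'" if "0 \<le> g" "g < g'" for g g'
  proof -
    have "(\<Sum>k\<in>{2..K}. p 1 / (1 + g' * p k / p 1)) \<le> (\<Sum>k\<in>{2..K}. p 1 / (1 + g * p k / p 1))"
    proof (intro sum_mono divide_left_mono add_left_mono divide_right_mono mult_right_mono mult_pos_pos)
      fix k assume k: "k \<in> {2..K}"
      show "0 < 1 + g * p k / p 1" "0 < 1 + g' * p k / p 1" using pos[OF _ k] that by auto
      show "0 \<le> p k" using pk[OF k] by simp
    qed (use p1 that in auto)
    moreover have "beta * g < beta * g'" using that \<open>beta > 0\<close> by simp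
    ultimately show ?thesis by (simp add: H_def)
  qed
  \<comment> \<open>Each summand is at most \<open>p 1\<close>, so this value already makes
    \<open>H\<close> reach \<open>R\<close> and bounds the search interval.\<close>
  define b where "b = real Nr * p 1 / beta"
  have b: "b \<ge> 0" using p1 \<open>beta > 0\<close> by (simp add: b_def)
  have H0: "H 0 < R"
  proof -
    have "H 0 = - (real (K - 1) * p 1)" by (simp add: H_def)
    moreover have "R = real Nr * p 1 - real (K - 1) * p 1" by (simp add: R_def algebra_simps)
    moreover have "real Nr * p 1 > 0" using p1 assms by simp
    ultimately show ?thesis by simp
  qed
  have Hb: "R \<le> H b"
  proof -
    have "(\<Sum>k\<in>{2..K}. p 1 / (1 + b * p k / p 1)) \<le> (\<Sum>k\<in>{2..K}. p 1)"
    proof (intro sum_mono)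
      fix k assume k: "k \<in> {2..K}"
      have "1 \<le> 1 + b * p k / p 1" using pk[OF k] p1 b by simp
      then show "p 1 / (1 + b * p k / p 1) \<le> p 1" using p1 by (simp add: divide_le_eq)
    qed
    moreover have "beta * b = real Nr * p 1" using \<open>beta > 0\<close> by (simp add: b_def)
    ultimately show ?thesis by (simp add: H_def R_def algebra_simps)
  qed
  have "continuous_on {0..b} H"
    unfolding H_def by (intro continuous_intros) (use pos p1 in \<open>force+\<close>)
  then obtain g where g: "0 \<le> g" "g \<le> b" "H g = R"
    using IVT'[of H 0 R b] H0 Hb b by auto
  then have "g > 0" using H0 by (cases "g = 0") auto
  show ?thesis
  proof (rule ex1I[of _ g])
    show "g > 0 \<and> gbar_eq Nr K ph beta g" using g \<open>g > 0\<close> eq by simp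
    fix g' assume "g' > 0 \<and> gbar_eq Nr K ph beta g'"
    then have "g' > 0" "H g' = H g" using eq g by auto
    then show "g' = g" using mono[of g g'] mono[of g' g] \<open>g > 0\<close> by (cases g g' rule: linorder_cases) auto
  qed
qed

text \<open>The difference is the sum T divided by beta. Each term of T is at most p_1^2 / (g p_k),
  and g is of order Nr, so fewer than Nr such terms stay bounded: the error is O(1), more than the
  o(Nr) asked for.\<close>

lemma gbar_asymptotics:
  fixes p :: "nat \<Rightarrow> real"
  assumes ph: "\<And>k. k \<in> {1..K} \<Longrightarrow> ph k = complex_of_real (p k)"
    and p: "\<And>k. k \<in> {1..K} \<Longrightarrow> lo \<le> p k \<and> p k \<le> hi"
    and K: "1 \<le> K" "real K \<le> (1 - \<delta>) * real Nr" and "1 \<le> Nr"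
    and "0 < lo" "0 < \<delta>" and beta: "lo \<le> beta" "beta \<le> hi"
  shows "\<bar>p 1 * (real Nr - real (K - 1)) / beta - gbar Nr K ph beta\<bar> \<le> hi ^ 3 / (lo ^ 3 * \<delta>)"
proof -
  define g where "g = gbar Nr K ph beta"
  have p0: "p k > 0" if "k \<in> {1..K}" for k using p[OF that] \<open>0 < lo\<close> by linarith
  have p1: "p 1 > 0" "lo \<le> p 1" "p 1 \<le> hi" using p[of 1] p0[of 1] K by auto
  have b0: "beta > 0" and hi: "hi > 0" using beta \<open>0 < lo\<close> by auto
  have "(1 - \<delta>) * real Nr \<le> 1 * real Nr"
    using \<open>0 < \<delta>\<close> by (intro mult_right_mono) auto
  then have KN: "K \<le> Nr" using K(2) by simp
  have "g > 0 \<and> gbar_eq Nr K ph beta g"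
    unfolding g_def gbar_def by (rule theI'[OF gbar_ex1[OF ph p0 K(1) KN b0]])
  then have g0: "g > 0" and eq: "beta * g = p 1 * (real Nr - real (K - 1)) + (\<Sum>k\<in>{2..K}. p 1 / (1 + g * p k / p 1))"
    using gbar_eq_iff[OF ph p0 K(1)] by auto
  define T where "T = (\<Sum>k\<in>{2..K}. p 1 / (1 + g * p k / p 1))"
  have pos: "1 + g * p k / p 1 > 0" if "k \<in> {2..K}" for k
    using p0[of k] that p1 g0 by (intro add_pos_pos) auto
  have T0: "T \<ge> 0" unfolding T_def using pos p1 by (intro sum_nonneg divide_nonneg_pos) auto
  \<comment> \<open>Dropping T from the equation bounds g from below, and this feeds back into the
    bound on T.\<close>
  have low: "lo * \<delta> * real Nr \<le> beta * g"
  proof -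
    have "\<delta> * real Nr \<le> real Nr - real (K - 1)" using K by (simp add: algebra_simps)
    then have "lo * (\<delta> * real Nr) \<le> p 1 * (real Nr - real (K - 1))"
      using p1 \<open>0 < lo\<close> \<open>0 < \<delta>\<close> by (intro mult_mono) auto
    then show ?thesis using eq T0 by (simp add: T_def)
  qed
  have "T \<le> (\<Sum>k\<in>{2..K}. hi\<^sup>2 / (g * lo))"
    unfolding T_def
  proof (rule sum_mono)
    fix k assume k: "k \<in> {2..K}"
    then have pk: "lo \<le> p k" using p by auto
    have "p 1 / (1 + g * p k / p 1) \<le> p 1 / (g * p k / p 1)"
      using p1 g0 p0[of k] k pos[OF k] by (intro divide_left_mono mult_pos_pos) auto
    also have "\<dots> = (p 1)\<^sup>2 / (g * p k)" by (simp add: power2_eq_square)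
    also have "\<dots> \<le> hi\<^sup>2 / (g * lo)"
      using p1 pk g0 \<open>0 < lo\<close> by (intro frac_le mult_left_mono power_mono) auto
    finally show "p 1 / (1 + g * p k / p 1) \<le> hi\<^sup>2 / (g * lo)" .
  qed
  also have "\<dots> = real (K - 1) * (hi\<^sup>2 / (g * lo))" by simp
  also have "\<dots> \<le> real Nr * (hi\<^sup>2 / (g * lo))"
    using KN g0 \<open>0 < lo\<close> by (intro mult_right_mono) auto
  finally have "T / beta \<le> real Nr * hi\<^sup>2 / (beta * g * lo)"
    using b0 by (simp add: field_simps)
  also have "\<dots> \<le> real Nr * hi\<^sup>2 / (lo * \<delta> * real Nr * lo)"
    using low \<open>0 < lo\<close> \<open>0 < \<delta>\<close> \<open>1 \<le> Nr\<close> b0 g0 by (intro divide_left_mono mult_right_mono mult_pos_pos) auto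
  also have "\<dots> = hi\<^sup>2 / (lo\<^sup>2 * \<delta>)"
    using \<open>1 \<le> Nr\<close> by (simp add: power2_eq_square)
  also have "\<dots> \<le> hi ^ 3 / (lo ^ 3 * \<delta>)"
    using beta \<open>0 < lo\<close> \<open>0 < \<delta>\<close> hi by (simp add: field_simps power2_eq_square power3_eq_cube)
  finally have "T / beta \<le> hi ^ 3 / (lo ^ 3 * \<delta>)" .
  moreover have "p 1 * (real Nr - real (K - 1)) / beta - g = - (T / beta)"
    using eq b0 by (simp add: T_def field_simps)
  moreover have "T / beta \<ge> 0" using T0 b0 by simp
  ultimately show ?thesis by (simp add: g_def)
qed

section \<open>Positivity of the channel parameters and the uniform gap\<close>

lemma phis_positive_real:
  assumes "valid_params K Nr taup sp2 sd2 alpha P Pp c a" "k \<in> {1..K}"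
  shows "\<exists>p>0. phis sp2 taup alpha P Pp c a k = complex_of_real p"
    "zerr (c k) (s_noise sp2 taup (alpha k) (Pp k)) (a k) > 0"
proof -
  define s where "s = s_noise sp2 taup (alpha k) (Pp k)"
  define m where "m = (cmod (a k))\<^sup>2"
  have pos: "alpha k > 0" "P k > 0" "Pp k > 0" "c k > 0" "sp2 > 0" "taup \<ge> 1"
    and ak: "cmod (a k) < 1"
    using assms by (auto simp: valid_params_def)
  have s: "s > 0" using pos by (simp add: s_def s_noise_def)
  have m: "0 \<le> m" "m < 1" using ak by (auto simp: m_def abs_square_less_1)
  have "m * (c k)\<^sup>2 < 1 * (c k)\<^sup>2" using m pos by (intro mult_strict_right_mono) auto
  also have "\<dots> < (c k + s)\<^sup>2" using pos s by (simp add: power_strict_mono)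
  finally have den: "den_k (c k) s (a k) > 0" by (simp add: den_k_def m_def)
  have "m * c k < 1 * c k" using m pos by (intro mult_strict_right_mono) auto
  then have num: "c k + s - m * c k > 0" using s by simp
  show "zerr (c k) (s_noise sp2 taup (alpha k) (Pp k)) (a k) > 0"
    using pos s den num by (simp add: zerr_def m_def flip: s_def)
  have eh: "ehat (c k) s (a k) > 0"
    using pos den num by (simp add: ehat_def m_def)
  \<comment> \<open>\<open>echeck\<close> carries a factor a that meets cnj a in
    \<open>phi_k\<close>, so only |a|^2 survives and the complex expression is real.\<close>
  define p where "p = (alpha k)\<^sup>2 * P k * (ehat (c k) s (a k) * c k + m * (c k * s / den_k (c k) s (a k)) * c k)"
  have "p > 0"
    unfolding p_def using pos s den m eh by (intro mult_pos_pos add_pos_nonneg mult_nonneg_nonneg) auto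
  moreover have "a k * cnj (a k) = complex_of_real m"
    unfolding m_def by (rule complex_norm_square[symmetric])
  then have "echeck (c k) s (a k) * complex_of_real (c k) * cnj (a k)
      = complex_of_real (m * (c k * s / den_k (c k) s (a k)) * c k)"
    unfolding echeck_def of_real_mult by (metis mult.assoc mult.commute)
  then have "phis sp2 taup alpha P Pp c a k = complex_of_real p"
    by (simp add: phis_def phi_k_def p_def flip: s_def)
  ultimately show "\<exists>p>0. phis sp2 taup alpha P Pp c a k = complex_of_real p" by blast
qed

lemma beta_tot_positive:
  assumes "valid_params K Nr taup sp2 sd2 alpha P Pp c a"
  shows "beta_tot K sp2 sd2 taup alpha P Pp c a > 0"
proof -
  have "(\<Sum>k\<in>{1..K}. (alpha k)\<^sup>2 * P k * zerr (c k) (s_noise sp2 taup (alpha k) (Pp k)) (a k)) \<ge> 0"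
  proof (rule sum_nonneg)
    fix k assume k: "k \<in> {1..K}"
    then have "P k > 0" using assms by (simp add: valid_params_def)
    with phis_positive_real(2)[OF assms k]
    show "(alpha k)\<^sup>2 * P k * zerr (c k) (s_noise sp2 taup (alpha k) (Pp k)) (a k) \<ge> 0"
      by simp
  qed
  then show ?thesis
    using assms by (simp add: beta_tot_def valid_params_def)
qed

lemma limsup_ratio_less_1:
  assumes "limsup (\<lambda>n. ereal (real (K n) / real n)) < 1"
  obtains \<delta> N where "\<delta> > 0" "1 \<le> N" "\<And>n. N \<le> n \<Longrightarrow> real (K n) \<le> (1 - \<delta>) * real n"
proof -
  obtain r where r: "limsup (\<lambda>n. ereal (real (K n) / real n)) < ereal r" "ereal r < 1"
    using ereal_dense2[OF assms] by blast
  have "\<forall>\<^sub>F n in sequentially. ereal (real (K n) / real n) < ereal r"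
    using r(1) by (rule Limsup_lessD)
  then obtain N where N: "\<And>n. N \<le> n \<Longrightarrow> real (K n) / real n < r"
    by (auto simp: eventually_sequentially)
  show thesis
  \<comment> \<open>At n = 0 the quotient is 0 by convention and says nothing about
    \<open>K 0\<close>, so the threshold is at least 1.\<close>
  proof (rule that[of "1 - r" "max 1 N"])
    show "0 < 1 - r" using r(2) by simp
    fix n assume "max 1 N \<le> n"
    then show "real (K n) \<le> (1 - (1 - r)) * real n" using N[of n] by (simp add: field_simps)
  qed simp
qed

text \<open>Both the SINR and its equivalent are compared with the explicit value
  \<open>m n\<close>; the random part is \<open>Z n\<close> and the deterministic part is O(1/n).
  Positive bounds lo and hi replace the compact set.\<close>

lemma (in prob_space) sinr_convergence:
  fixes v :: "nat \<Rightarrow> nat \<Rightarrow> real"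
  assumes ph: "\<And>n k. 1 \<le> n \<Longrightarrow> k \<in> {1..K n} \<Longrightarrow> ph n k = complex_of_real (v n k)"
    and v: "\<And>n k. 1 \<le> n \<Longrightarrow> k \<in> {1..K n} \<Longrightarrow> lo \<le> v n k \<and> v n k \<le> hi"
    and beta: "\<And>n. 1 \<le> n \<Longrightarrow> lo \<le> beta n \<and> beta n \<le> hi" and lo: "0 < lo"
    and K: "\<And>n. 1 \<le> n \<Longrightarrow> 1 \<le> K n" and limsup: "limsup (\<lambda>n. ereal (real (K n) / real n)) < 1"
    and CN: "\<And>n. 1 \<le> n \<Longrightarrow> indep_CN_vectors M n (K n) (v n) (X n)"
  defines "\<gamma> \<equiv> \<lambda>n \<omega>. sinr n (K n) (beta n) (X n 1 \<omega>) (\<lambda>k. X n k \<omega>)"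
    and "gb \<equiv> \<lambda>n. gbar n (K n) (ph n) (beta n)"
  shows "AE \<omega> in M. (\<lambda>n. (\<gamma> n \<omega> - complex_of_real (gb n)) / of_nat n) \<longlonglongrightarrow> 0"
    and "(\<lambda>n. (expectation (\<gamma> n) - complex_of_real (gb n)) / of_nat n) \<longlonglongrightarrow> 0"
proof -
  obtain \<delta> N where \<delta>: "\<delta> > 0" and N: "1 \<le> N" and KN: "\<And>n. N \<le> n \<Longrightarrow> real (K n) \<le> (1 - \<delta>) * real n"
    using limsup_ratio_less_1[OF limsup] by metis
  define m where "m n = v n 1 * (real n - real (K n - 1)) / beta n" for n
  define Z where "Z n \<omega> = (Re (\<gamma> n \<omega>) - m n) / real n" for n \<omega>
  define C where "C = (356 * hi\<^sup>2 / lo\<^sup>2)\<^sup>2"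
  define c where "c = lo * \<delta> / (2 * hi)"
  define D where "D = 8 * C + 8 * (hi / lo) ^ 4 * (1 / c\<^sup>2 + C / c ^ 4)"
  have sinr: "\<gamma> n \<in> borel_measurable M" "\<gamma> n \<omega> = complex_of_real (Re (\<gamma> n \<omega>))"
    "integrable M (\<lambda>\<omega>. Z n \<omega> ^ 4)" "expectation (\<lambda>\<omega>. Z n \<omega> ^ 4) \<le> D / (real n)\<^sup>2"
    if n: "N \<le> n" for n \<omega>
  proof -
    have n1: "1 \<le> n" using n N by simp
    note * = sinr_fourth_moment[OF CN[OF n1] K[OF n1] KN[OF n] lo \<delta> n1 v[OF n1]
        conjunct1[OF beta[OF n1]] conjunct2[OF beta[OF n1]]]
    show "\<gamma> n \<in> borel_measurable M" "\<gamma> n \<omega> = complex_of_real (Re (\<gamma> n \<omega>))"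
      using *(1,2) by (simp_all only: \<gamma>_def)
    show "integrable M (\<lambda>\<omega>. Z n \<omega> ^ 4)" "expectation (\<lambda>\<omega>. Z n \<omega> ^ 4) \<le> D / (real n)\<^sup>2"
      using *(3,4) by (simp_all only: \<gamma>_def Z_def m_def D_def C_def c_def)
  qed
  have Zm: "Z n \<in> borel_measurable M" if "N \<le> n" for n
    unfolding Z_def using sinr(1)[OF that] by measurable
  have conv: "AE \<omega> in M. (\<lambda>n. Z n \<omega>) \<longlonglongrightarrow> 0" "(\<lambda>n. expectation (Z n)) \<longlonglongrightarrow> 0"
      "\<And>n. N \<le> n \<Longrightarrow> integrable M (Z n)"
    using fourth_moment_summable_convergence[OF Zm sinr(3,4) N] by simp_all
  have det: "(\<lambda>n. (m n - gb n) / real n) \<longlonglongrightarrow> 0"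
  proof (rule Lim_null_comparison)
    show "\<forall>\<^sub>F n in sequentially. norm ((m n - gb n) / real n) \<le> hi ^ 3 / (lo ^ 3 * \<delta>) / real n"
    proof (rule eventually_sequentiallyI)
      fix n assume n: "N \<le> n"
      then have n1: "1 \<le> n" using N by simp
      have "\<bar>m n - gb n\<bar> \<le> hi ^ 3 / (lo ^ 3 * \<delta>)"
        unfolding m_def gb_def using ph[OF n1] v[OF n1] K[OF n1] KN[OF n] n1 lo \<delta> beta[OF n1]
        by (intro gbar_asymptotics) auto
      then show "norm ((m n - gb n) / real n) \<le> hi ^ 3 / (lo ^ 3 * \<delta>) / real n"
        using divide_right_mono[of "\<bar>m n - gb n\<bar>" "hi ^ 3 / (lo ^ 3 * \<delta>)" "real n"] by (simp add: abs_divide)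
    qed
    show "(\<lambda>n. hi ^ 3 / (lo ^ 3 * \<delta>) / real n) \<longlonglongrightarrow> 0"
      by (rule lim_const_over_n)
  qed
  have split: "(\<gamma> n \<omega> - complex_of_real (gb n)) / of_nat n = complex_of_real (Z n \<omega> + (m n - gb n) / real n)"
    if "N \<le> n" for n \<omega>
    by (subst sinr(2)[OF that]) (simp add: Z_def diff_divide_distrib)
  show "AE \<omega> in M. (\<lambda>n. (\<gamma> n \<omega> - complex_of_real (gb n)) / of_nat n) \<longlonglongrightarrow> 0"
    using conv(1)
  proof eventually_elim
    case (elim \<omega>)
    have "(\<lambda>n. complex_of_real (Z n \<omega> + (m n - gb n) / real n)) \<longlonglongrightarrow> complex_of_real (0 + 0)"
      by (intro tendsto_of_real tendsto_add elim det)
    moreover have "\<forall>\<^sub>F n in sequentially. complex_of_real (Z n \<omega> + (m n - gb n) / real n)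
        = (\<gamma> n \<omega> - complex_of_real (gb n)) / of_nat n"
      using split by (intro eventually_sequentiallyI[of N]) presburger
    ultimately show ?case
      using Lim_transform_eventually by fastforce
  qed
  have "complex_of_real (expectation (Z n) + (m n - gb n) / real n)
      = (expectation (\<gamma> n) - complex_of_real (gb n)) / of_nat n" if n: "N \<le> n" for n
  proof -
    have n0: "real n > 0" using n N by simp
    \<comment> \<open>The SINR is a complex expression, but from N on it is real at every sample
      point, so its expectation is that of a real variable.\<close>
    have "\<gamma> n \<omega> = complex_of_real (real n * Z n \<omega> + m n)" for \<omega>
      by (subst sinr(2)[OF n]) (use n0 in \<open>simp add: Z_def\<close>)
    then have "expectation (\<gamma> n) = (\<integral>\<omega>. complex_of_real (real n * Z n \<omega> + m n) \<partial>M)"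
      by presburger
    also have "\<dots> = complex_of_real (\<integral>\<omega>. real n * Z n \<omega> + m n \<partial>M)"
      by (rule integral_complex_of_real)
    also have "(\<integral>\<omega>. real n * Z n \<omega> + m n \<partial>M) = real n * expectation (Z n) + m n"
      using conv(3)[OF n] by (simp add: prob_space)
    finally show ?thesis using n0 by (simp add: field_simps)
  qed
  then have "\<forall>\<^sub>F n in sequentially. complex_of_real (expectation (Z n) + (m n - gb n) / real n)
      = (expectation (\<gamma> n) - complex_of_real (gb n)) / of_nat n"
    by (rule eventually_sequentiallyI)
  moreover have "(\<lambda>n. complex_of_real (expectation (Z n) + (m n - gb n) / real n)) \<longlonglongrightarrow> complex_of_real (0 + 0)"
    by (intro tendsto_of_real tendsto_add conv(2) det)
  ultimately show "(\<lambda>n. (expectation (\<gamma> n) - complex_of_real (gb n)) / of_nat n) \<longlonglongrightarrow> 0"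
    using Lim_transform_eventually by fastforce
qed

theorem theorem2:
  shows
  "(\<forall>(K::nat) (Nr::nat) (taup::nat) (sp2::real) (sd2::real)
       (alpha::nat\<Rightarrow>real) (P::nat\<Rightarrow>real) (Pp::nat\<Rightarrow>real) (c::nat\<Rightarrow>real) (a::nat\<Rightarrow>complex).
      valid_params K Nr taup sp2 sd2 alpha P Pp c a \<longrightarrow>
      (\<exists>!g::real. g > 0 \<and>
         gbar_eq Nr K (phis sp2 taup alpha P Pp c a) (beta_tot K sp2 sd2 taup alpha P Pp c a) g))
   \<and>
   (\<forall>(M::'a measure) (K::nat\<Rightarrow>nat) (taup::nat\<Rightarrow>nat) (sp2::nat\<Rightarrow>real) (sd2::nat\<Rightarrow>real)
       (alpha::nat\<Rightarrow>nat\<Rightarrow>real) (P::nat\<Rightarrow>nat\<Rightarrow>real) (Pp::nat\<Rightarrow>nat\<Rightarrow>real) (c::nat\<Rightarrow>nat\<Rightarrow>real)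
       (a::nat\<Rightarrow>nat\<Rightarrow>complex) (X::nat\<Rightarrow>nat\<Rightarrow>'a\<Rightarrow>nat\<Rightarrow>complex) (C::real set).
      prob_space M \<and>
      (\<forall>Nr\<ge>1. valid_params (K Nr) Nr (taup Nr) (sp2 Nr) (sd2 Nr)
                              (alpha Nr) (P Nr) (Pp Nr) (c Nr) (a Nr)) \<and>
      limsup (\<lambda>Nr. ereal (real (K Nr) / real Nr)) < 1 \<and>
      compact C \<and> C \<subseteq> {0<..} \<and>
      (\<forall>Nr\<ge>1. (\<forall>k\<in>{1..K Nr}. phis (sp2 Nr) (taup Nr) (alpha Nr) (P Nr) (Pp Nr) (c Nr) (a Nr) k
                                  \<in> complex_of_real ` C) \<and>
               beta_tot (K Nr) (sp2 Nr) (sd2 Nr) (taup Nr) (alpha Nr) (P Nr) (Pp Nr) (c Nr) (a Nr) \<in> C) \<and>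
      (\<forall>Nr\<ge>1. indep_CN_vectors M Nr (K Nr)
                 (\<lambda>k. Re (phis (sp2 Nr) (taup Nr) (alpha Nr) (P Nr) (Pp Nr) (c Nr) (a Nr) k)) (X Nr))
      \<longrightarrow>
      (let beta = (\<lambda>Nr. beta_tot (K Nr) (sp2 Nr) (sd2 Nr) (taup Nr) (alpha Nr) (P Nr) (Pp Nr) (c Nr) (a Nr));
           gb = (\<lambda>Nr. gbar Nr (K Nr) (phis (sp2 Nr) (taup Nr) (alpha Nr) (P Nr) (Pp Nr) (c Nr) (a Nr))
                        (beta Nr));
           gamma = (\<lambda>Nr \<omega>. sinr Nr (K Nr) (beta Nr) (X Nr 1 \<omega>) (\<lambda>k. X Nr k \<omega>))
       in (AE \<omega> in M. (\<lambda>Nr. (gamma Nr \<omega> - complex_of_real (gb Nr)) / of_nat Nr) \<longlonglongrightarrow> 0) \<and>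
          (\<lambda>Nr. (prob_space.expectation M (gamma Nr) - complex_of_real (gb Nr)) / of_nat Nr)
             \<longlonglongrightarrow> 0))"
proof (intro conjI allI impI)
  fix K Nr taup :: nat and sp2 sd2 :: real and alpha P Pp c :: "nat \<Rightarrow> real" and a :: "nat \<Rightarrow> complex"
  assume valid: "valid_params K Nr taup sp2 sd2 alpha P Pp c a"
  define p where "p k = Re (phis sp2 taup alpha P Pp c a k)" for k
  have p: "phis sp2 taup alpha P Pp c a k = complex_of_real (p k)" "p k > 0" if "k \<in> {1..K}" for k
    using phis_positive_real(1)[OF valid that] by (auto simp: p_def)
  show "\<exists>!g. g > 0 \<and>
      gbar_eq Nr K (phis sp2 taup alpha P Pp c a) (beta_tot K sp2 sd2 taup alpha P Pp c a) g"
    using valid beta_tot_positive[OF valid] by (intro gbar_ex1[OF p]) (auto simp: valid_params_def)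
next
  fix M :: "'a measure" and K taup :: "nat \<Rightarrow> nat" and sp2 sd2 :: "nat \<Rightarrow> real"
    and alpha P Pp c :: "nat \<Rightarrow> nat \<Rightarrow> real" and a :: "nat \<Rightarrow> nat \<Rightarrow> complex"
    and X :: "nat \<Rightarrow> nat \<Rightarrow> 'a \<Rightarrow> nat \<Rightarrow> complex" and C :: "real set"
  let ?ph = "\<lambda>Nr. phis (sp2 Nr) (taup Nr) (alpha Nr) (P Nr) (Pp Nr) (c Nr) (a Nr)"
  let ?beta = "\<lambda>Nr. beta_tot (K Nr) (sp2 Nr) (sd2 Nr) (taup Nr) (alpha Nr) (P Nr) (Pp Nr) (c Nr) (a Nr)"
  assume A: "prob_space M \<and>
      (\<forall>Nr\<ge>1. valid_params (K Nr) Nr (taup Nr) (sp2 Nr) (sd2 Nr)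
                              (alpha Nr) (P Nr) (Pp Nr) (c Nr) (a Nr)) \<and>
      limsup (\<lambda>Nr. ereal (real (K Nr) / real Nr)) < 1 \<and>
      compact C \<and> C \<subseteq> {0<..} \<and>
      (\<forall>Nr\<ge>1. (\<forall>k\<in>{1..K Nr}. ?ph Nr k \<in> complex_of_real ` C) \<and> ?beta Nr \<in> C) \<and>
      (\<forall>Nr\<ge>1. indep_CN_vectors M Nr (K Nr) (\<lambda>k. Re (?ph Nr k)) (X Nr))"
  then interpret prob_space M by blast
  have C: "compact C" "C \<subseteq> {0<..}" "?beta 1 \<in> C" using A by auto
  \<comment> \<open>The value of beta at Nr = 1 shows that \<open>C\<close> is nonempty, and the
    minimum is positive because it is attained in \<open>C\<close>.\<close>
  obtain lo where lo: "lo \<in> C" "\<And>x. x \<in> C \<Longrightarrow> lo \<le> x"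
    using compact_attains_inf[of C] C by auto
  obtain hi where hi: "\<And>x. x \<in> C \<Longrightarrow> x \<le> hi"
    using compact_attains_sup[of C] C by auto
  have phC: "?ph n k = complex_of_real (Re (?ph n k))" "Re (?ph n k) \<in> C" if "1 \<le> n" "k \<in> {1..K n}" for n k
  proof -
    have "?ph n k \<in> complex_of_real ` C" using A that by blast
    then show "?ph n k = complex_of_real (Re (?ph n k))" "Re (?ph n k) \<in> C" by auto
  qed
  have betaC: "?beta n \<in> C" if "1 \<le> n" for n using A that by blast
  have K: "1 \<le> K n" if "1 \<le> n" for n using A that by (auto simp: valid_params_def)
  have CN: "indep_CN_vectors M n (K n) (\<lambda>k. Re (?ph n k)) (X n)" if "1 \<le> n" for n using A that by blast
  have lo0: "0 < lo" using lo(1) C by auto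
  have limsup: "limsup (\<lambda>Nr. ereal (real (K Nr) / real Nr)) < 1" using A by blast
  have vb: "lo \<le> Re (?ph n k) \<and> Re (?ph n k) \<le> hi" if "1 \<le> n" "k \<in> {1..K n}" for n k
    using phC(2)[OF that] lo(2) hi by blast
  have bb: "lo \<le> ?beta n \<and> ?beta n \<le> hi" if "1 \<le> n" for n
    using betaC[OF that] lo(2) hi by blast
  note conv = sinr_convergence[where ph = ?ph and v = "\<lambda>n k. Re (?ph n k)" and beta = ?beta,
      OF phC(1) vb bb lo0 K limsup CN]
  show "let beta = ?beta;
           gb = (\<lambda>Nr. gbar Nr (K Nr) (?ph Nr) (beta Nr));
           gamma = (\<lambda>Nr \<omega>. sinr Nr (K Nr) (beta Nr) (X Nr 1 \<omega>) (\<lambda>k. X Nr k \<omega>))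
       in (AE \<omega> in M. (\<lambda>Nr. (gamma Nr \<omega> - complex_of_real (gb Nr)) / of_nat Nr) \<longlonglongrightarrow> 0) \<and>
          (\<lambda>Nr. (prob_space.expectation M (gamma Nr) - complex_of_real (gb Nr)) / of_nat Nr) \<longlonglongrightarrow> 0"
    unfolding Let_def by (intro conjI conv)
qed

end
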